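(* For every integer $\ell\geq 3$ and every constant $L>0$ there exists $n_0=n_0(\ell,L)$ such that for every integer $n\ge n_0$, $$|\mathcal{G}_n(2\ell, L)|\leq 2^{3(\ell+1)n^{1+1/\ell}}.$$
   Context: For a graph $G$ on $[n]=\{1,\ldots,n\}$, an integer $k\ge 3$ and an edge $uv\in E(G)$, $c_k(u,v;G)$ denotes the number of cycles of length $k$ in $G$ containing the edge $uv$. For an integer $s\ge 3$ and $L>0$, $\mathcal{G}_n(s,L)$ is the family of (simple, labelled) graphs $G$ on vertex set $[n]$ such that $c_k(u,v;G)\le L$ for every $3\le k\le s$ and every $uv\in E(G)$. *)

theory Defs
  imports Complex_Main
begin

text \<open>
  A labelled simple graph on the fixed vertex set \<open>{1..n}\<close> is represented by its edge set, a set of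
  two-element subsets of \<open>{1..n}\<close>; distinct graphs correspond to distinct edge sets.
\<close>

definition simple_graphs :: "nat \<Rightarrow> nat set set set" where
  "simple_graphs n = {G. \<forall>e\<in>G. \<exists>u\<in>{1..n}. \<exists>v\<in>{1..n}. u \<noteq> v \<and> e = {u, v}}"

definition cycle_edges :: "'a list \<Rightarrow> 'a set set" where
  "cycle_edges xs = {{xs ! i, xs ! (Suc i mod length xs)} |i. i < length xs}"

text \<open>
  Cycles are subgraphs: the \<open>2 * k\<close> cyclic sequences that differ only in starting point
  or orientation have the same edge set and are counted once. As \<open>k \<ge> 3\<close>, the edge set determines
  the cycle.
\<close>

definition cycles :: "nat \<Rightarrow> 'a set set \<Rightarrow> 'a set set set" where
  "cycles k G = {cycle_edges xs |xs. k \<ge> 3 \<and> length xs = k \<and> distinct xs \<and> cycle_edges xs \<subseteq> G}"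

definition num_cycles_through :: "nat \<Rightarrow> 'a \<Rightarrow> 'a \<Rightarrow> 'a set set \<Rightarrow> nat" where
  "num_cycles_through k u v G = card {C \<in> cycles k G. {u, v} \<in> C}"

definition few_cycle_graphs :: "nat \<Rightarrow> nat \<Rightarrow> real \<Rightarrow> nat set set set" where
  "few_cycle_graphs n s L =
     {G \<in> simple_graphs n.
        \<forall>k u v. 3 \<le> k \<and> k \<le> s \<and> {u, v} \<in> G \<longrightarrow> real (num_cycles_through k u v G) \<le> L}"

end

theory Submission
  imports Defs "HOL-Analysis.Convex" "HOL-Analysis.Harmonic_Numbers" "HOL-Real_Asymp.Real_Asymp"
begin

text \<open>
The count is of Kleitman--Winston type. Write \<open>N\<close> for \<open>n\<close> to the power \<open>1 / l\<close>. A graph is built up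
by repeatedly adding a vertex \<open>v\<close> that has minimum degree \<open>d\<close> in the new graph; there are \<open>n\<close> such
steps, so it suffices that each neighbourhood \<open>I\<close> of \<open>v\<close> can be chosen in at most
\<open>2 powr ((3 * l + 1) * N)\<close> ways. Every vertex of the old graph \<open>G\<close> has degree at least \<open>d - 1\<close>.

The cycle hypothesis enters only through \<open>fan_bounded\<close>: for an edge \<open>py\<close>, the number of further edges
\<open>yz\<close> whose end \<open>z\<close> is joined to \<open>p\<close> by a short walk avoiding \<open>y\<close> is at most a constant \<open>K\<close>, because
each such \<open>z\<close> closes a short cycle through \<open>py\<close>. This has three consequences.

\<^item> Breadth-first search branches: up to depth \<open>l - 1\<close>, all but at most \<open>K + 1\<close> of the neighbours of a
vertex are its children. So every vertex \<open>u\<close> carries a tree with \<open>q = d - 2 - K\<close> children at each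
node and a bottom layer of exactly \<open>q ^ (l - 1)\<close> distinct vertices.
\<^item> For \<open>u \<noteq> w\<close> the two bottom layers share at most \<open>l * (K + 1) * q ^ (l - 2)\<close> vertices.
\<^item> Call \<open>u\<close> and \<open>w\<close> close if their bottom layers meet. Close vertices are joined by a walk of length
\<open>2 * l - 2\<close>, so each vertex of \<open>I\<close> is close to at most \<open>K\<close> others in \<open>I\<close>: the set \<open>I\<close> is almost
independent in the closeness graph.

By Cauchy--Schwarz the first two facts make closeness dense on every vertex set \<open>S\<close> with more
than \<open>2 * n / q ^ (l - 1)\<close> elements: some vertex of \<open>S\<close> is close to a fraction \<open>\<beta>\<close> of \<open>S\<close>, where
\<open>\<beta>\<close> is of order \<open>q ^ l / n\<close>. Hence almost independent sets are few: choosing a vertex of large degree for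
\<open>I\<close> excludes, up to \<open>K\<close> exceptions, a fraction \<open>\<beta>\<close> of the candidates, so after about \<open>ln n / \<beta>\<close> choices
at most \<open>2 * n / q ^ (l - 1)\<close> candidates are left.

If \<open>d \<le> N / log 2 (n + 1)\<close>, then the trivial bound \<open>(n + 1) ^ d\<close> is good enough. Otherwise \<open>1 / \<beta>\<close> is
polylogarithmic and the choices made on the way cost only \<open>2 powr N\<close>. At most \<open>4 * n / d ^ (l - 1)\<close>
candidates remain, and they have at most \<open>2 powr ((l + 6) * N)\<close> subsets of size at most \<open>d\<close>,
whatever the value of \<open>d\<close>. The constant \<open>K\<close> affects lower-order terms only, which is why the
final exponent does not depend on \<open>L\<close>.
\<close>

section \<open>Cycles that share two incident edges\<close>

definition edges_on :: "'a set \<Rightarrow> 'a set set" where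
  "edges_on V = {{u, v} |u v. u \<in> V \<and> v \<in> V \<and> u \<noteq> v}"

lemma edges_on_noloop: "G \<subseteq> edges_on V \<Longrightarrow> {a, b} \<in> G \<Longrightarrow> a \<noteq> b"
  by (auto simp: edges_on_def doubleton_eq_iff subset_iff)

lemma edges_on_mem: "G \<subseteq> edges_on V \<Longrightarrow> {a, b} \<in> G \<Longrightarrow> a \<in> V \<and> b \<in> V"
  by (auto simp: edges_on_def doubleton_eq_iff subset_iff)

definition nbrs :: "'a set set \<Rightarrow> 'a \<Rightarrow> 'a set" where
  "nbrs G x = {y. {x, y} \<in> G}"

definition adj :: "'a set set \<Rightarrow> ('a \<times> 'a) set" where
  "adj G = {(a, b). {a, b} \<in> G}"

text \<open>
The cycle condition in the form in which it is used. The graph \<open>{e\<in>G. y \<notin> e}\<close> is \<open>G\<close> with \<open>y\<close>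
removed, so each \<open>z\<close> witnesses a cycle through the edges \<open>py\<close> and \<open>yz\<close>. Speaking about walks
instead of cycles makes the condition inherited by subgraphs and spares any further handling of
cyclic sequences.
\<close>

definition fan_bounded :: "nat \<Rightarrow> nat \<Rightarrow> 'a set set \<Rightarrow> bool" where
  "fan_bounded r K G \<longleftrightarrow>
     (\<forall>p y Z. {p, y} \<in> G \<and> finite Z \<and>
        (\<forall>z\<in>Z. {y, z} \<in> G \<and> z \<noteq> p \<and> (\<exists>m\<le>r. (p, z) \<in> adj {e\<in>G. y \<notin> e} ^^ m))
        \<longrightarrow> card Z \<le> K)"

lemma adj_mono: "G \<subseteq> H \<Longrightarrow> adj G \<subseteq> adj H"
  by (auto simp: adj_def)

lemma adj_relpow_mono:
  assumes "G \<subseteq> H" shows "adj G ^^ m \<subseteq> adj H ^^ m"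
  using adj_mono[OF assms] by (induction m) (auto intro!: relcomp_mono)

lemma fan_bounded_mono:
  assumes "fan_bounded r K H" "G \<subseteq> H"
  shows "fan_bounded r K G"
  unfolding fan_bounded_def
proof (intro allI impI, elim conjE)
  fix p y Z
  assume *: "{p, y} \<in> G" "finite Z"
    "\<forall>z\<in>Z. {y, z} \<in> G \<and> z \<noteq> p \<and> (\<exists>m\<le>r. (p, z) \<in> adj {e \<in> G. y \<notin> e} ^^ m)"
  have "adj {e \<in> G. y \<notin> e} ^^ m \<subseteq> adj {e \<in> H. y \<notin> e} ^^ m" for m
    by (rule adj_relpow_mono) (use assms(2) in auto)
  then have "\<forall>z\<in>Z. {y, z} \<in> H \<and> z \<noteq> p \<and> (\<exists>m\<le>r. (p, z) \<in> adj {e \<in> H. y \<notin> e} ^^ m)"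
    using *(3) assms(2) by blast
  then show "card Z \<le> K"
    using assms *(1,2) unfolding fan_bounded_def by blast
qed

lemma adj_relpow_sym: "(a, b) \<in> adj G ^^ m \<Longrightarrow> (b, a) \<in> adj G ^^ m"
proof (induction m arbitrary: b)
  case (Suc m)
  then obtain c where "(a, c) \<in> adj G ^^ m" "(c, b) \<in> adj G" by auto
  then have "(b, c) \<in> adj G" "(c, a) \<in> adj G ^^ m"
    using Suc.IH by (auto simp: adj_def insert_commute)
  then show ?case by (rule relpow_Suc_I2)
qed auto

lemma relpow_trans: "(a, b) \<in> R ^^ i \<Longrightarrow> (b, c) \<in> R ^^ j \<Longrightarrow> (a, c) \<in> R ^^ (i + j)"
  by (auto simp: relpow_add)

lemma shortest_walk_distinct:
  assumes "(p, z) \<in> R ^^ m"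
  obtains f :: "nat \<Rightarrow> 'a" and k where "k \<le> m" "f 0 = p" "f k = z"
    "\<And>i. i < k \<Longrightarrow> (f i, f (Suc i)) \<in> R" "inj_on f {..k}"
proof -
  define k where "k = (LEAST j. (p, z) \<in> R ^^ j)"
  have k: "(p, z) \<in> R ^^ k" "k \<le> m" and least: "\<And>j. (p, z) \<in> R ^^ j \<Longrightarrow> k \<le> j"
    unfolding k_def
    by (rule LeastI[where P = "\<lambda>j. (p, z) \<in> R ^^ j", OF assms],
        rule Least_le[where P = "\<lambda>j. (p, z) \<in> R ^^ j", OF assms],
        rule Least_le[where P = "\<lambda>j. (p, z) \<in> R ^^ j"])
  obtain f where f: "f 0 = p" "f k = z" "\<And>i. i < k \<Longrightarrow> (f i, f (Suc i)) \<in> R"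
    using k(1) by (auto simp: relpow_fun_conv)
  have seg: "(f i, f (i + j)) \<in> R ^^ j" if "i + j \<le> k" for i j
    unfolding relpow_fun_conv using f(3) that
    by (intro exI[of _ "\<lambda>t. f (i + t)"]) auto
  have "f i \<noteq> f j" if "i < j" "j \<le> k" for i j
  proof
    assume eq: "f i = f j"
    have "(p, f i) \<in> R ^^ i" "(f j, z) \<in> R ^^ (k - j)"
      using seg[of 0 i] seg[of j "k - j"] f that by auto
    then have "(p, z) \<in> R ^^ (i + (k - j))"
      using relpow_trans eq by metis
    then show False using least[of "i + (k - j)"] that by auto
  qed
  then have "inj_on f {..k}"
    by (auto simp: inj_on_def) (metis linorder_neqE_nat)
  with k f that show thesis by blast
qed

text \<open>
A shortest walk is a path, and the removed vertex \<open>y\<close> turns the path from \<open>p\<close> to \<open>z\<close> into a cycle.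
\<close>

lemma walk_closes_to_cycle:
  assumes "(p, z) \<in> adj {e\<in>G. y \<notin> e} ^^ m" "z \<noteq> p" "{p, y} \<in> G" "{y, z} \<in> G" "p \<noteq> y" "z \<noteq> y"
  obtains k C where "3 \<le> k" "k \<le> m + 2" "C \<in> cycles k G" "{p, y} \<in> C" "{y, z} \<in> C" 
proof -
  from assms(1) obtain f k where f: "k \<le> m" "f 0 = p" "f k = z"
    "\<And>i. i < k \<Longrightarrow> (f i, f (Suc i)) \<in> adj {e\<in>G. y \<notin> e}" "inj_on f {..k}"
    by (rule shortest_walk_distinct) blast
  have k0: "k \<noteq> 0" using f assms by (intro notI) auto
  define xs where "xs = y # map f [0..<Suc k]"
  have len: "length xs = k + 2" by (simp add: xs_def)
  have edge: "{f i, f (Suc i)} \<in> G" "y \<noteq> f i" "y \<noteq> f (Suc i)" if "i < k" for i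
    using f(4)[OF that] by (auto simp: adj_def)
  have notin: "y \<noteq> f i" if "i \<le> k" for i
    using that edge(2)[of i] assms f by (cases "i = k") auto
  have "distinct xs" unfolding xs_def 
    using notin f(5) by (auto simp: distinct_map atLeast0LessThan lessThan_Suc_atMost simp del: upt_Suc)
  have nth: "xs ! 0 = y" "\<And>i. i \<le> k \<Longrightarrow> xs ! (Suc i) = f i" 
    unfolding xs_def by (simp_all del: upt_Suc)
  have sub: "cycle_edges xs \<subseteq> G"
  proof
    fix e assume "e \<in> cycle_edges xs"
    then obtain i where i: "i < k + 2" "e = {xs ! i, xs ! (Suc i mod (k + 2))}"
      by (auto simp: cycle_edges_def len)
    consider "i = 0" | j where "i = Suc j" "j < k" | "i = Suc k"
      using i(1) by (cases i) (auto simp: less_Suc_eq)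
    then show "e \<in> G"
    proof cases
      case 1 then show ?thesis using i nth(1) nth(2)[of 0] f assms by (simp add: insert_commute)
    next
      case (2 j) then show ?thesis using i nth edge by simp
    next
      case 3 then show ?thesis using i nth(1) nth(2)[of k] f assms by (simp add: insert_commute)
    qed
  qed
  have first: "{p, y} \<in> cycle_edges xs" unfolding cycle_edges_def len
    using nth(1) nth(2)[of 0] f by (auto intro!: exI[of _ 0])
  have last: "{y, z} \<in> cycle_edges xs" unfolding cycle_edges_def len
    using nth(1) nth(2)[of k] f by (auto intro!: exI[of _ "Suc k"])
  have "cycle_edges xs \<in> cycles (k + 2) G"
    unfolding cycles_def using k0 len \<open>distinct xs\<close> sub by (intro CollectI exI[of _ xs]) simp
  with k0 f(1) first last show thesis
    by (intro that[of "k + 2" "cycle_edges xs"]) simp_all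
qed

lemma card_cycle:
  assumes "C \<in> cycles k G"
  shows "finite C" "card C \<le> k"
proof -
  obtain xs where xs: "C = cycle_edges xs" "length xs = k"
    using assms by (auto simp: cycles_def)
  have "C = (\<lambda>i. {xs ! i, xs ! (Suc i mod length xs)}) ` {..<k}"
    using xs by (auto simp: cycle_edges_def)
  then show "finite C" "card C \<le> k"
    using card_image_le[of "{..<k}" "\<lambda>i. {xs ! i, xs ! (Suc i mod length xs)}"] by simp_all
qed

lemma simple_graphs_eq: "simple_graphs n = Pow (edges_on {1..n})"
  unfolding simple_graphs_def edges_on_def Pow_def by blast

lemma finite_edges_on: "finite V \<Longrightarrow> finite (edges_on V)"
  by (rule finite_subset[of _ "Pow V"]) (auto simp: edges_on_def)

text \<open>
Each \<open>z\<close> lies on a cycle through \<open>py\<close> of some length \<open>k\<close> between \<open>3\<close> and \<open>2 * l\<close>. There are at most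
\<open>2 * l * L\<close> such cycles, and a single one serves at most \<open>k\<close> vertices \<open>z\<close>, as it has only \<open>k\<close> edges.
\<close>

lemma few_cycle_graphs_fan_bounded:
  assumes G: "G \<in> few_cycle_graphs n (2 * l) L" and l: "l \<ge> 1" and K: "4 * real l ^ 2 * L \<le> real K"
  shows "fan_bounded (2 * l - 2) K G"
  unfolding fan_bounded_def
proof (intro allI impI, elim conjE)
  fix p y Z
  assume py: "{p, y} \<in> G" and "finite Z"
    and Z: "\<forall>z\<in>Z. {y, z} \<in> G \<and> z \<noteq> p \<and> (\<exists>m\<le>2 * l - 2. (p, z) \<in> adj {e \<in> G. y \<notin> e} ^^ m)"
  have sub: "G \<subseteq> edges_on {1..n}" 
    and few: "\<And>k. 3 \<le> k \<Longrightarrow> k \<le> 2 * l \<Longrightarrow> real (num_cycles_through k p y G) \<le> L"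
    using G py by (auto simp: few_cycle_graphs_def simple_graphs_eq)
  have finG: "finite G" using sub finite_edges_on finite_subset by blast
  define \<C> where "\<C> = (\<Union>k\<in>{3..2*l}. {C \<in> cycles k G. {p, y} \<in> C})"
  have "cycles k G \<subseteq> Pow G" for k by (auto simp: cycles_def)
  then have fin_c: "finite (cycles k G)" for k
    using finG finite_subset by blast
  have fin\<C>: "finite \<C>" unfolding \<C>_def using fin_c by auto
  have L0: "L \<ge> 0" if "l \<ge> 2"
  proof -
    have "real (num_cycles_through 3 p y G) \<le> L" using few[of 3] that by auto
    then show ?thesis using of_nat_0_le_iff order_trans by blast
  qed
  show "card Z \<le> K"
  proof (cases "l \<ge> 2")
    case False
    then have "l = 1" using l by auto
    then have "Z = {}" using Z by auto
    then show ?thesis by simp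
  next
    case True
    have c\<C>: "real (card \<C>) \<le> 2 * real l * L"
    proof -
      have "card \<C> \<le> (\<Sum>k\<in>{3..2*l}. num_cycles_through k p y G)"
        unfolding \<C>_def num_cycles_through_def by (rule card_UN_le) simp
      then have "real (card \<C>) \<le> (\<Sum>k\<in>{3..2*l}. real (num_cycles_through k p y G))"
        by (metis of_nat_le_iff of_nat_sum)
      also have "\<dots> \<le> real (card {3..2*l}) * L"
        using few by (intro sum_bounded_above) auto
      also have "\<dots> \<le> 2 * real l * L"
        using L0[OF True] by (intro mult_right_mono) auto
      finally show ?thesis .
    qed
    have "Z \<subseteq> (\<Union>C\<in>\<C>. {z. {y, z} \<in> C})"
    proof
      fix z assume "z \<in> Z"
      with Z obtain m where m: "m \<le> 2 * l - 2" "(p, z) \<in> adj {e \<in> G. y \<notin> e} ^^ m"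
        "{y, z} \<in> G" "z \<noteq> p" by blast
      have "p \<noteq> y" "z \<noteq> y" using edges_on_noloop[OF sub] py m by blast+
      then obtain k C where "3 \<le> k" "k \<le> m + 2" "C \<in> cycles k G" "{p, y} \<in> C" "{y, z} \<in> C"
        using walk_closes_to_cycle[OF m(2,4) py m(3)] by blast
      then show "z \<in> (\<Union>C\<in>\<C>. {z. {y, z} \<in> C})"
        unfolding \<C>_def using m(1) l by (auto intro!: bexI[of _ k] exI[of _ C])
    qed
    moreover have per_cycle: "finite {z. {y, z} \<in> C} \<and> card {z. {y, z} \<in> C} \<le> 2 * l" if "C \<in> \<C>" for C
    proof -
      from that obtain k where "k \<le> 2 * l" "C \<in> cycles k G" by (auto simp: \<C>_def)
      then have C: "finite C" "card C \<le> 2 * l" using card_cycle[of C k G] by auto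
      have inj: "inj_on (\<lambda>z. {y, z}) {z. {y, z} \<in> C}"
        by (auto simp: inj_on_def doubleton_eq_iff)
      have im: "(\<lambda>z. {y, z}) ` {z. {y, z} \<in> C} \<subseteq> C" by auto
      show ?thesis
        using inj_on_finite[OF inj im C(1)] card_inj_on_le[OF inj im C(1)] C(2) by auto
    qed
    ultimately have "card Z \<le> card (\<Union>C\<in>\<C>. {z. {y, z} \<in> C})"
      using fin\<C> by (intro card_mono) auto
    also have "\<dots> \<le> (\<Sum>C\<in>\<C>. card {z. {y, z} \<in> C})"
      using fin\<C> by (rule card_UN_le)
    also have "\<dots> \<le> card \<C> * (2 * l)"
      using per_cycle by (intro sum_bounded_above[where K = "2 * l", simplified]) auto
    finally have "real (card Z) \<le> real (card \<C> * (2 * l))" by (rule of_nat_mono)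
    then have "real (card Z) \<le> real (card \<C>) * (2 * real l)" by simp
    also have "\<dots> \<le> (2 * real l * L) * (2 * real l)"
      using c\<C> by (intro mult_right_mono) auto
    also have "\<dots> = 4 * real l ^ 2 * L" by (simp add: power2_eq_square)
    finally show ?thesis using K by linarith
  qed
qed

section \<open>Truncated breadth-first trees\<close>

definition level :: "'a set set \<Rightarrow> 'a \<Rightarrow> nat \<Rightarrow> 'a set" where
  "level G u i = {x. (u, x) \<in> adj G ^^ i \<and> (\<forall>j<i. (u, x) \<notin> adj G ^^ j)}"

definition parent :: "'a set set \<Rightarrow> 'a \<Rightarrow> nat \<Rightarrow> 'a \<Rightarrow> 'a" where
  "parent G u i x = (SOME y. y \<in> level G u i \<and> {y, x} \<in> G)"

lemma level_0 [simp]: "level G u 0 = {u}"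
  by (auto simp: level_def)

lemma level_disjoint: "x \<in> level G u i \<Longrightarrow> x \<in> level G u j \<Longrightarrow> i = j"
  unfolding level_def by (metis (mono_tags, lifting) linorder_neqE_nat mem_Collect_eq)

lemma walk_ends_in_level:
  assumes "(u, x) \<in> adj G ^^ m"
  obtains k where "k \<le> m" "x \<in> level G u k"
proof -
  define k where "k = (LEAST j. (u, x) \<in> adj G ^^ j)"
  have "(u, x) \<in> adj G ^^ k" "k \<le> m"
    unfolding k_def
    by (rule LeastI[where P = "\<lambda>j. (u, x) \<in> adj G ^^ j", OF assms],
        rule Least_le[where P = "\<lambda>j. (u, x) \<in> adj G ^^ j", OF assms])
  moreover have "\<forall>j<k. (u, x) \<notin> adj G ^^ j"
    unfolding k_def using not_less_Least by blast
  ultimately show thesis using that[of k] by (auto simp: level_def)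
qed

lemma parent:
  assumes "x \<in> level G u (Suc i)"
  shows "parent G u i x \<in> level G u i" "{parent G u i x, x} \<in> G"
proof -
  obtain y where y: "(u, y) \<in> adj G ^^ i" "(y, x) \<in> adj G"
    using assms by (auto simp: level_def)
  have "(u, y) \<notin> adj G ^^ j" if "j < i" for j
  proof
    assume "(u, y) \<in> adj G ^^ j"
    then have "(u, x) \<in> adj G ^^ Suc j" using y(2) by auto
    moreover have "(u, x) \<notin> adj G ^^ Suc j" 
      using assms that unfolding level_def by (blast intro: Suc_mono)
    ultimately show False by blast
  qed
  with y have "y \<in> level G u i \<and> {y, x} \<in> G" by (auto simp: level_def adj_def)
  then have "parent G u i x \<in> level G u i \<and> {parent G u i x, x} \<in> G"
    unfolding parent_def by (rule someI)
  then show "parent G u i x \<in> level G u i" "{parent G u i x, x} \<in> G" by auto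
qed

text \<open>
All vertices of a walk of length \<open>k\<close> from \<open>u\<close> are within distance \<open>k\<close> of \<open>u\<close>, and \<open>y\<close> is not.
\<close>

lemma short_walk_avoids_far_vertex:
  assumes "(u, x) \<in> adj G ^^ k" "\<forall>j\<le>k. (u, y) \<notin> adj G ^^ j"
  shows "(u, x) \<in> adj {e\<in>G. y \<notin> e} ^^ k"
  using assms
proof (induction k arbitrary: x)
  case (Suc k)
  then obtain z where z: "(u, z) \<in> adj G ^^ k" "(z, x) \<in> adj G" by auto
  have "z \<noteq> y" "x \<noteq> y" using Suc.prems z(1) le_Suc_eq by blast+
  then have "(z, x) \<in> adj {e\<in>G. y \<notin> e}" using z(2) by (auto simp: adj_def)
  moreover have "(u, z) \<in> adj {e\<in>G. y \<notin> e} ^^ k" using Suc z(1) by auto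
  ultimately show ?case by auto
qed auto

text \<open>
Follow the breadth-first tree from \<open>x\<close> up to \<open>u\<close>: the first two vertices are not \<open>y\<close> by assumption, and
the remaining ones lie too close to \<open>u\<close> to be \<open>y\<close>. Any two vertices to which this applies are joined
by a walk through \<open>u\<close> that avoids \<open>y\<close>, which is how the fan bound is brought to bear below.
\<close>

lemma tree_walk_avoids_nonparent:
  assumes x: "x \<in> level G u (Suc i)" and "x \<noteq> y" "parent G u i x \<noteq> y"
    and far: "\<forall>j<i. (u, y) \<notin> adj G ^^ j"
  shows "(u, x) \<in> adj {e\<in>G. y \<notin> e} ^^ Suc i"
proof -
  let ?H = "{e\<in>G. y \<notin> e}"
  have "(u, parent G u i x) \<in> adj ?H ^^ i"
  proof (cases i)
    case 0
    then show ?thesis using parent(1)[OF x] by simp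
  next
    case (Suc k)
    define z where "z = parent G u k (parent G u i x)"
    have z: "z \<in> level G u k" "{z, parent G u i x} \<in> G"
      using parent[OF parent(1)[OF x, unfolded Suc]] by (simp_all add: z_def Suc)
    then have walk: "(u, z) \<in> adj ?H ^^ k"
      using far Suc by (intro short_walk_avoids_far_vertex) (auto simp: level_def)
    have "z \<noteq> y" using far z(1) Suc by (auto simp: level_def)
    then have "(z, parent G u i x) \<in> adj ?H" using z(2) assms(3) by (auto simp: adj_def)
    with walk show ?thesis using Suc by auto
  qed
  moreover have "(parent G u i x, x) \<in> adj ?H"
    using parent(2)[OF x] assms(2,3) by (auto simp: adj_def)
  ultimately show ?thesis by auto
qed

text \<open>
The \<open>K + 1\<close> spare neighbours of each vertex pay for its parent and for the at most \<open>K\<close> neighbours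
that fail to be its children in a breadth-first tree, leaving \<open>q\<close> children.
\<close>

locale fan_graph =
  fixes V :: "'a set" and G :: "'a set set" and l K q :: nat
  assumes finV: "finite V" and sub: "G \<subseteq> edges_on V"
    and fan: "fan_bounded (2 * l - 2) K G"
    and deg: "\<And>x. x \<in> V \<Longrightarrow> q + K + 1 \<le> card (nbrs G x)"
begin

lemma fan_card:
  assumes "{p, y} \<in> G" "finite Z"
    and "\<And>z. z \<in> Z \<Longrightarrow> {y, z} \<in> G \<and> z \<noteq> p \<and> (\<exists>m\<le>2 * l - 2. (p, z) \<in> adj {e\<in>G. y \<notin> e} ^^ m)"
  shows "card Z \<le> K"
  using fan assms unfolding fan_bounded_def by blast

lemma nbrs_sub: "nbrs G x \<subseteq> V"
  using edges_on_mem[OF sub] by (auto simp: nbrs_def)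

lemma finite_nbrs: "finite (nbrs G x)"
  by (rule finite_subset[OF nbrs_sub finV])

definition children :: "'a \<Rightarrow> nat \<Rightarrow> 'a \<Rightarrow> 'a set" where
  "children u i y = {x \<in> level G u (Suc i). parent G u i x = y}"

lemma children_nbrs: "children u i y \<subseteq> nbrs G y"
  using parent(2) by (auto simp: children_def nbrs_def)

lemma finite_children: "finite (children u i y)"
  by (rule finite_subset[OF children_nbrs finite_nbrs])

text \<open>
Let \<open>p\<close> be the parent of \<open>y\<close>. A neighbour \<open>z \<noteq> p\<close> of \<open>y\<close> that is not a child of \<open>y\<close> is reached from the
root by tree edges that avoid \<open>y\<close>, and so is \<open>p\<close>. Both tree walks together join \<open>p\<close> to \<open>z\<close>, so there
are at most \<open>K\<close> such \<open>z\<close>. At the root all neighbours are children.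
\<close>

lemma many_children:
  assumes y: "y \<in> level G u i" "y \<in> V" and i: "Suc i < l"
  shows "q \<le> card (children u i y)"
proof (cases i)
  case 0
  have "nbrs G u \<subseteq> children u 0 u"
  proof
    fix x assume x: "x \<in> nbrs G u"
    then have "u \<noteq> x" using edges_on_noloop[OF sub] by (auto simp: nbrs_def)
    then have "x \<in> level G u (Suc 0)" using x by (auto simp: level_def nbrs_def adj_def)
    then show "x \<in> children u 0 u" using parent(1)[of x G u 0] by (auto simp: children_def)
  qed
  moreover have "y = u" using y 0 by simp
  moreover have "finite (children u 0 u)" by (rule finite_subset[OF children_nbrs finite_nbrs])
  ultimately have "card (nbrs G y) \<le> card (children u i y)" using 0 by (simp add: card_mono)
  then show ?thesis using deg[OF y(2)] by linarith
next
  case (Suc k)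
  define p where "p = parent G u k y"
  have p: "p \<in> level G u k" "{p, y} \<in> G" using parent[of y G u k] y(1) Suc by (simp_all add: p_def)
  \<comment> \<open>the neighbours that are lost: neither the parent nor a child\<close>
  define Z where "Z = nbrs G y - insert p (children u i y)"
  have far: "\<forall>j<i. (u, y) \<notin> adj G ^^ j" using y by (auto simp: level_def)
  have walk_p: "(p, u) \<in> adj {e\<in>G. y \<notin> e} ^^ k"
    by (rule adj_relpow_sym, rule short_walk_avoids_far_vertex)
      (use p(1) far Suc in \<open>auto simp: level_def\<close>)
  have "card Z \<le> K"
  proof (rule fan_card[OF p(2)])
    show "finite Z" unfolding Z_def using finite_nbrs by blast
  next
    fix z assume "z \<in> Z"
    then have z: "{y, z} \<in> G" "z \<noteq> p" "z \<notin> children u i y" by (auto simp: Z_def nbrs_def)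
    have "z \<noteq> y" using edges_on_noloop[OF sub] z(1) by blast
    have "(u, z) \<in> adj G ^^ Suc i" using y(1) z(1) by (auto simp: level_def adj_def)
    then obtain m where m: "m \<le> Suc i" "z \<in> level G u m" by (rule walk_ends_in_level)
    have "(u, z) \<in> adj {e\<in>G. y \<notin> e} ^^ m"
    proof (cases m)
      case 0
      then show ?thesis using m by simp
    next
      case (Suc j)
      have "parent G u j z \<noteq> y"
      proof
        assume eq: "parent G u j z = y"
        have "parent G u j z \<in> level G u j" using parent(1)[of z G u j] m Suc by simp
        then have "j = i" using eq y(1) level_disjoint[of y G u j i] by simp
        then show False using z(3) eq m Suc by (auto simp: children_def)
      qed
      then show ?thesis unfolding Suc
        using m Suc far \<open>z \<noteq> y\<close> by (intro tree_walk_avoids_nonparent) auto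
    qed
    then have "(p, z) \<in> adj {e\<in>G. y \<notin> e} ^^ (k + m)" by (rule relpow_trans[OF walk_p])
    moreover have "k + m \<le> 2 * l - 2" using i m(1) Suc by linarith
    ultimately show "{y, z} \<in> G \<and> z \<noteq> p \<and> (\<exists>m\<le>2 * l - 2. (p, z) \<in> adj {e\<in>G. y \<notin> e} ^^ m)"
      using z by blast
  qed
  moreover have "card (nbrs G y) \<le> card (Z \<union> insert p (children u i y))"
    using finite_nbrs finite_children unfolding Z_def by (intro card_mono) auto
  moreover have "\<dots> \<le> card Z + (1 + card (children u i y))"
    using card_Un_le[of Z "insert p (children u i y)"] finite_children[of u i y]
    by (simp add: card_insert_if split: if_splits)
  ultimately show ?thesis using deg[OF y(2)] by linarith
qed

text \<open>
Truncating to exactly \<open>q\<close> children keeps the layers from being too large, which matters for the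
upper bound on common vertices of two layers.
\<close>

definition kids :: "'a \<Rightarrow> nat \<Rightarrow> 'a \<Rightarrow> 'a set" where
  "kids u i y = (SOME A. A \<subseteq> children u i y \<and> card A = q)"

lemma kids:
  assumes "y \<in> level G u i" "y \<in> V" "Suc i < l"
  shows "kids u i y \<subseteq> children u i y" "card (kids u i y) = q"
proof -
  have "\<exists>A. A \<subseteq> children u i y \<and> card A = q"
    using obtain_subset_with_card_n[OF many_children[OF assms]] by blast
  then have "kids u i y \<subseteq> children u i y \<and> card (kids u i y) = q"
    unfolding kids_def by (rule someI_ex)
  then show "kids u i y \<subseteq> children u i y" "card (kids u i y) = q" by auto
qed

primrec layer :: "'a \<Rightarrow> nat \<Rightarrow> 'a set" where
  "layer u 0 = {u}"
| "layer u (Suc i) = (\<Union>y\<in>layer u i. kids u i y)"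

lemma layer:
  assumes "u \<in> V" "i < l"
  shows "layer u i \<subseteq> level G u i \<inter> V \<and> card (layer u i) = q ^ i"
  using assms(2)
proof (induction i)
  case 0
  then show ?case using assms(1) by simp
next
  case (Suc i)
  then have IH: "layer u i \<subseteq> level G u i \<inter> V" "card (layer u i) = q ^ i" by auto
  have k: "kids u i y \<subseteq> children u i y" "card (kids u i y) = q" if "y \<in> layer u i" for y
    using kids[of y u i] IH that Suc.prems by auto
  have "layer u (Suc i) \<subseteq> level G u (Suc i) \<inter> V"
    using k(1) children_nbrs nbrs_sub by (fastforce simp: children_def)
  moreover have "card (layer u (Suc i)) = (\<Sum>y\<in>layer u i. card (kids u i y))"
    unfolding layer.simps
  proof (rule card_UN_disjoint)
    show "finite (layer u i)" using IH(1) by (intro finite_subset[OF _ finV]) blast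
    show "\<forall>y\<in>layer u i. finite (kids u i y)"
      using k(1) finite_subset[OF _ finite_children] by blast
    show "\<forall>y\<in>layer u i. \<forall>y'\<in>layer u i. y \<noteq> y' \<longrightarrow> kids u i y \<inter> kids u i y' = {}"
      using k(1) unfolding children_def by blast
  qed
  ultimately show ?case using k(2) IH(2) by simp
qed

lemma finite_layer: "u \<in> V \<Longrightarrow> i < l \<Longrightarrow> finite (layer u i)"
  using layer by (intro finite_subset[OF _ finV]) blast

text \<open>
A common vertex \<open>x\<close> of the next layers is a child of some \<open>y\<close> in the tree of \<open>u\<close>. If \<open>y\<close> is also the
parent of \<open>x\<close> in the tree of \<open>w\<close>, then \<open>y\<close> is common to the previous layers, and each such \<open>y\<close>
accounts for at most \<open>q\<close> vertices \<open>x\<close>. Otherwise the tree of \<open>w\<close> reaches \<open>x\<close> without using \<open>y\<close>; two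
such children of the same \<open>y\<close> are joined by a walk avoiding \<open>y\<close>, so each of the \<open>q ^ i\<close> vertices \<open>y\<close>
has at most \<open>K + 1\<close> of them.
\<close>

lemma layer_codegree:
  assumes "u \<in> V" "w \<in> V" "u \<noteq> w" "i < l"
  shows "card (layer u i \<inter> layer w i) \<le> i * (K + 1) * q ^ (i - 1)"
  using assms(4)
proof (induction i)
  case 0
  then show ?case using assms(3) by simp
next
  case (Suc i)
  have lu: "layer u i \<subseteq> level G u i \<inter> V" "card (layer u i) = q ^ i"
    and lw: "layer w i \<subseteq> level G w i \<inter> V"
    using layer[of _ i] assms Suc.prems by auto
  have ku: "kids u i y \<subseteq> children u i y" "card (kids u i y) = q" if "y \<in> layer u i" for y
    using kids[of y u i] lu that Suc.prems by auto
  have kw: "kids w i y \<subseteq> children w i y" if "y \<in> layer w i" for y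
    using kids[of y w i] lw that Suc.prems by auto
  have fink: "finite (kids u i y)" if "y \<in> layer u i" for y
    by (rule finite_subset[OF ku(1)[OF that] finite_children])
  \<comment> \<open>the children of \<open>y\<close> whose parent in the other tree is a different vertex\<close>
  define X where "X y = {x \<in> kids u i y \<inter> layer w (Suc i). parent G w i x \<noteq> y}" for y
  have X: "card (X y) \<le> K + 1" if y: "y \<in> layer u i" for y
  proof (cases "X y = {}")
    case False
    \<comment> \<open>one of these children takes the part of \<open>p\<close> in the fan bound\<close>
    then obtain x1 where x1: "x1 \<in> X y" by blast
    have walk: "(w, x) \<in> adj {e\<in>G. y \<notin> e} ^^ Suc i" and yx: "{y, x} \<in> G" if "x \<in> X y" for x
    proof -
      have "x \<in> children u i y" "parent G w i x \<noteq> y" "x \<in> layer w (Suc i)"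
        using that ku(1)[OF y] by (auto simp: X_def)
      then have e: "{y, x} \<in> G" and s: "x \<in> level G w (Suc i)"
        using children_nbrs layer[OF assms(2) Suc.prems] by (auto simp: nbrs_def)
      have "(w, y) \<notin> adj G ^^ j" if "j < i" for j
      proof
        assume "(w, y) \<in> adj G ^^ j"
        then have "(w, x) \<in> adj G ^^ Suc j" using e by (auto simp: adj_def)
        moreover have "(w, x) \<notin> adj G ^^ Suc j"
          using s that unfolding level_def by (blast intro: Suc_mono)
        ultimately show False by blast
      qed
      moreover have "x \<noteq> y" using edges_on_noloop[OF sub e] by simp
      ultimately show "(w, x) \<in> adj {e\<in>G. y \<notin> e} ^^ Suc i"
        using s \<open>parent G w i x \<noteq> y\<close> by (intro tree_walk_avoids_nonparent) auto
      show "{y, x} \<in> G" by (rule e)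
    qed
    have "card (X y - {x1}) \<le> K"
    proof (rule fan_card)
      show "{x1, y} \<in> G" using yx[OF x1] by (simp add: insert_commute)
      show "finite (X y - {x1})" unfolding X_def using fink[OF y] by simp
      fix z assume z: "z \<in> X y - {x1}"
      have "(x1, z) \<in> adj {e\<in>G. y \<notin> e} ^^ (Suc i + Suc i)"
        using adj_relpow_sym[OF walk[OF x1]] walk z by (blast intro: relpow_trans)
      moreover have "Suc i + Suc i \<le> 2 * l - 2" using Suc.prems by linarith
      ultimately show "{y, z} \<in> G \<and> z \<noteq> x1 \<and> (\<exists>m\<le>2 * l - 2. (x1, z) \<in> adj {e\<in>G. y \<notin> e} ^^ m)"
        using yx z by blast
    qed
    then show ?thesis using x1 by (simp add: card_Diff_singleton)
  qed auto
  have "layer u (Suc i) \<inter> layer w (Suc i)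
      \<subseteq> (\<Union>y\<in>layer u i. X y) \<union> (\<Union>y\<in>layer u i \<inter> layer w i. kids u i y)"
  proof
    fix x assume x: "x \<in> layer u (Suc i) \<inter> layer w (Suc i)"
    then obtain y y' where y: "y \<in> layer u i" "x \<in> kids u i y" "y' \<in> layer w i" "x \<in> kids w i y'"
      by auto
    have "parent G w i x = y'" using kw y(3,4) by (auto simp: children_def)
    then show "x \<in> (\<Union>y\<in>layer u i. X y) \<union> (\<Union>y\<in>layer u i \<inter> layer w i. kids u i y)"
      using x y by (cases "y' = y") (auto simp: X_def)
  qed
  moreover have fin: "finite (layer u i)" using finite_layer assms Suc.prems by simp
  moreover have "finite (X y)" if "y \<in> layer u i" for y using fink[OF that] by (simp add: X_def)
  ultimately have "card (layer u (Suc i) \<inter> layer w (Suc i))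
      \<le> card ((\<Union>y\<in>layer u i. X y) \<union> (\<Union>y\<in>layer u i \<inter> layer w i. kids u i y))"
    using fink by (intro card_mono finite_UnI finite_UN_I) auto
  also have "\<dots> \<le> card (\<Union>y\<in>layer u i. X y) + card (\<Union>y\<in>layer u i \<inter> layer w i. kids u i y)"
    by (rule card_Un_le)
  also have "card (\<Union>y\<in>layer u i. X y) \<le> (\<Sum>y\<in>layer u i. card (X y))"
    by (rule card_UN_le[OF fin])
  also have "\<dots> \<le> q ^ i * (K + 1)"
    using sum_bounded_above[of "layer u i" "\<lambda>y. card (X y)" "K + 1"] X lu(2) by auto
  also have "card (\<Union>y\<in>layer u i \<inter> layer w i. kids u i y)
      \<le> (\<Sum>y\<in>layer u i \<inter> layer w i. card (kids u i y))"
    by (rule card_UN_le) (use fin in simp)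
  also have "\<dots> = card (layer u i \<inter> layer w i) * q" using ku(2) by simp
  also have "\<dots> \<le> (i * (K + 1) * q ^ (i - 1)) * q"
    using Suc by (intro mult_right_mono) auto
  also have "\<dots> = i * (K + 1) * q ^ i" by (cases i) (auto simp: algebra_simps)
  finally show ?case by (simp add: algebra_simps)
qed

end

section \<open>Pairs of intersecting sets\<close>

text \<open>
Summed over all ordered pairs from \<open>S\<close>, the intersections have total size at least
\<open>(card S * D)\<^sup>2 / n\<close> by Cauchy--Schwarz, applied to the number of sets that contain a given point. The
diagonal contributes only \<open>card S * D\<close>, at most half of that, and every other pair contributes at
most \<open>M\<close>.
\<close>

lemma dense_intersection_graph:
  fixes \<Gamma> :: "'a \<Rightarrow> 'b set"
  assumes fin: "finite S" "finite V" and n: "card V \<le> n" "0 < n"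
    and \<Gamma>: "\<And>u. u \<in> S \<Longrightarrow> \<Gamma> u \<subseteq> V" "\<And>u. u \<in> S \<Longrightarrow> card (\<Gamma> u) = D"
    and codeg: "\<And>u w. u \<in> S \<Longrightarrow> w \<in> S \<Longrightarrow> u \<noteq> w \<Longrightarrow> card (\<Gamma> u \<inter> \<Gamma> w) \<le> M"
    and large: "2 * n \<le> card S * D"
  shows "\<exists>u\<in>S. real (card S) * real D ^ 2
           \<le> 2 * real n * real M * real (card {w\<in>S. w \<noteq> u \<and> \<Gamma> u \<inter> \<Gamma> w \<noteq> {}})"
proof (rule ccontr)
  define deg where "deg u = card {w\<in>S. w \<noteq> u \<and> \<Gamma> u \<inter> \<Gamma> w \<noteq> {}}" for u
  define b where "b u x = (of_bool (x \<in> \<Gamma> u) :: real)" for u x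
  define T where "T = real (card S) * real D"
  assume "\<not> ?thesis"
  then have small: "2 * real n * (real M * real (deg u)) < T * real D" if "u \<in> S" for u
    using that by (auto simp: deg_def T_def power2_eq_square not_le mult.assoc)
  have S: "S \<noteq> {}" using large n by auto
  have inter: "(\<Sum>x\<in>V. b u x * b w x) = real (card (\<Gamma> u \<inter> \<Gamma> w))" if "u \<in> S" "w \<in> S" for u w
  proof -
    have "(\<Sum>x\<in>V. b u x * b w x) = (\<Sum>x\<in>V. of_bool (x \<in> \<Gamma> u \<inter> \<Gamma> w))"
      by (intro sum.cong) (auto simp: b_def)
    also have "\<dots> = real (card (V \<inter> (\<Gamma> u \<inter> \<Gamma> w)))"
      using fin(2) by (simp add: sum_of_bool_eq Int_def)
    also have "V \<inter> (\<Gamma> u \<inter> \<Gamma> w) = \<Gamma> u \<inter> \<Gamma> w" using \<Gamma>(1) that by blast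
    finally show ?thesis .
  qed
  have bb: "b u x * b u x = b u x" for u x by (simp add: b_def)
  have "(\<Sum>x\<in>V. \<Sum>u\<in>S. b u x) = (\<Sum>u\<in>S. \<Sum>x\<in>V. b u x * b u x)"
    by (subst sum.swap) (simp add: bb)
  also have "\<dots> = (\<Sum>u\<in>S. real D)" using inter \<Gamma>(2) by (intro sum.cong) auto
  also have "\<dots> = T" by (simp add: T_def)
  finally have first: "(\<Sum>x\<in>V. \<Sum>u\<in>S. b u x) = T" .
  have "(\<Sum>x\<in>V. (\<Sum>u\<in>S. b u x)\<^sup>2) = (\<Sum>x\<in>V. \<Sum>u\<in>S. \<Sum>w\<in>S. b u x * b w x)"
    by (simp add: power2_eq_square sum_product)
  also have "\<dots> = (\<Sum>u\<in>S. \<Sum>x\<in>V. \<Sum>w\<in>S. b u x * b w x)" by (rule sum.swap)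
  also have "\<dots> = (\<Sum>u\<in>S. \<Sum>w\<in>S. \<Sum>x\<in>V. b u x * b w x)" by (intro sum.cong refl sum.swap)
  also have "\<dots> = (\<Sum>u\<in>S. \<Sum>w\<in>S. real (card (\<Gamma> u \<inter> \<Gamma> w)))"
    using inter by (intro sum.cong) auto
  finally have second: "(\<Sum>x\<in>V. (\<Sum>u\<in>S. b u x)\<^sup>2) = (\<Sum>u\<in>S. \<Sum>w\<in>S. real (card (\<Gamma> u \<inter> \<Gamma> w)))" .
  have row: "(\<Sum>w\<in>S. real (card (\<Gamma> u \<inter> \<Gamma> w))) \<le> real D + real M * real (deg u)" if u: "u \<in> S" for u
  proof -
    have "(\<Sum>w\<in>S. real (card (\<Gamma> u \<inter> \<Gamma> w)))
        = real (card (\<Gamma> u)) + (\<Sum>w\<in>S - {u}. real (card (\<Gamma> u \<inter> \<Gamma> w)))"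
      using sum.remove[OF fin(1) u, of "\<lambda>w. real (card (\<Gamma> u \<inter> \<Gamma> w))"] by simp
    also have "(\<Sum>w\<in>S - {u}. real (card (\<Gamma> u \<inter> \<Gamma> w)))
        = (\<Sum>w\<in>{w\<in>S. w \<noteq> u \<and> \<Gamma> u \<inter> \<Gamma> w \<noteq> {}}. real (card (\<Gamma> u \<inter> \<Gamma> w)))"
      using fin(1) by (intro sum.mono_neutral_right) auto
    also have "\<dots> \<le> real (deg u) * real M"
      unfolding deg_def using codeg u by (intro sum_bounded_above) auto
    finally show ?thesis using \<Gamma>(2)[OF u] by (simp add: mult.commute)
  qed
  have "T\<^sup>2 \<le> (\<Sum>x\<in>V. (\<Sum>u\<in>S. b u x)\<^sup>2) * real (card V)"
    using sum_squared_le_sum_of_squares[of "\<lambda>x. \<Sum>u\<in>S. b u x" V] fin(2) first by simp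
  also have "\<dots> \<le> (\<Sum>u\<in>S. \<Sum>w\<in>S. real (card (\<Gamma> u \<inter> \<Gamma> w))) * real n"
    unfolding second using n(1) by (intro mult_left_mono) (auto intro!: sum_nonneg)
  also have "\<dots> \<le> (\<Sum>u\<in>S. real D + real M * real (deg u)) * real n"
    using row by (intro mult_right_mono sum_mono) auto
  finally have "2 * T\<^sup>2 \<le> 2 * ((\<Sum>u\<in>S. real D + real M * real (deg u)) * real n)"
    by simp
  also have "\<dots> = (\<Sum>u\<in>S. 2 * real n * real D + 2 * real n * (real M * real (deg u)))"
    by (simp only: sum_distrib_left sum_distrib_right) (simp add: algebra_simps)
  also have "\<dots> < (\<Sum>u\<in>S. 2 * real n * real D + T * real D)"
    using small S fin(1) by (intro sum_strict_mono) auto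
  also have "\<dots> = 2 * real n * T + T\<^sup>2" by (simp add: T_def power2_eq_square algebra_simps)
  finally have "T * T < 2 * real n * T" by (simp add: power2_eq_square)
  then have "T < 2 * real n"
    by (metis T_def mult_less_cancel_right mult_nonneg_nonneg not_less of_nat_0_le_iff)
  moreover have "2 * real n \<le> T" using of_nat_mono[OF large, where 'a=real] by (simp add: T_def)
  ultimately show False by simp
qed

section \<open>Counting almost independent sets\<close>

lemma card_small_subsets:
  assumes "finite N"
  shows "card {A. A \<subseteq> N \<and> card A \<le> k} \<le> (card N + 1) ^ k"
proof (induction k)
  case 0
  have "{A. A \<subseteq> N \<and> card A \<le> 0} = {{}}" using assms finite_subset by fastforce
  then show ?case by simp
next
  case (Suc k)
  let ?F = "{A. A \<subseteq> N \<and> card A \<le> k}"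
  have fin: "finite ?F" using assms by simp
  have "{A. A \<subseteq> N \<and> card A \<le> Suc k} \<subseteq> ?F \<union> (\<lambda>(A, x). insert x A) ` (?F \<times> N)"
  proof
    fix A assume A: "A \<in> {A. A \<subseteq> N \<and> card A \<le> Suc k}"
    show "A \<in> ?F \<union> (\<lambda>(A, x). insert x A) ` (?F \<times> N)"
    proof (cases "card A \<le> k")
      case False
      then obtain x where x: "x \<in> A" by fastforce
      have "finite A" using A assms finite_subset by auto
      then have "(A - {x}, x) \<in> ?F \<times> N" "A = insert x (A - {x})" using A x by auto
      then show ?thesis by (metis (mono_tags, lifting) UnI2 case_prod_conv image_eqI)
    qed (use A in auto)
  qed
  then have "card {A. A \<subseteq> N \<and> card A \<le> Suc k} \<le> card (?F \<union> (\<lambda>(A, x). insert x A) ` (?F \<times> N))"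
    using fin assms by (intro card_mono) auto
  also have "\<dots> \<le> card ?F + card ((\<lambda>(A, x). insert x A) ` (?F \<times> N))" by (rule card_Un_le)
  also have "\<dots> \<le> card ?F + card (?F \<times> N)"
    using fin assms by (intro add_left_mono card_image_le) auto
  also have "\<dots> = card ?F * (card N + 1)" by (simp add: card_cartesian_product)
  also have "\<dots> \<le> (card N + 1) ^ k * (card N + 1)" by (rule mult_right_mono[OF Suc.IH]) simp
  finally show ?case by (simp add: mult.commute)
qed

lemma sum_power_card_Pow:
  fixes z :: real
  assumes "finite S"
  shows "(\<Sum>A\<in>Pow S. z ^ card A) = (1 + z) ^ card S"
  using assms
proof (induction S rule: finite_induct)
  case (insert x S)
  have inj: "inj_on (insert x) (Pow S)"
    using insert.hyps(2) by (auto simp: inj_on_def)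
  have "(\<Sum>A\<in>Pow (insert x S). z ^ card A)
      = (\<Sum>A\<in>Pow S. z ^ card A) + (\<Sum>A\<in>insert x ` Pow S. z ^ card A)"
    unfolding Pow_insert using insert.hyps by (intro sum.union_disjoint) auto
  also have "(\<Sum>A\<in>insert x ` Pow S. z ^ card A) = (\<Sum>A\<in>Pow S. z ^ card (insert x A))"
    using inj by (simp add: sum.reindex)
  also have "\<dots> = (\<Sum>A\<in>Pow S. z * z ^ card A)"
  proof (intro sum.cong refl)
    fix A assume "A \<in> Pow S"
    then have "finite A" "x \<notin> A" using insert.hyps finite_subset by auto
    then show "z ^ card (insert x A) = z * z ^ card A" by simp
  qed
  also have "\<dots> = z * (\<Sum>A\<in>Pow S. z ^ card A)" by (simp add: sum_distrib_left)
  finally show ?case using insert by (simp add: algebra_simps)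
qed simp

text \<open>
Weight each subset \<open>A\<close> of \<open>S\<close> by \<open>z ^ card A\<close>: the total weight is \<open>(1 + z) ^ card S\<close>, and a set of
size at most \<open>d\<close> has weight at least \<open>z ^ d\<close>.
\<close>

lemma card_small_subsets_exp:
  fixes z :: real
  assumes S: "finite S" and z: "0 < z" "z \<le> 1"
  shows "real (card {A. A \<subseteq> S \<and> card A \<le> d}) \<le> (1 / z) ^ d * exp (z * real (card S))"
proof -
  let ?F = "{A. A \<subseteq> S \<and> card A \<le> d}"
  have "real (card ?F) * z ^ d = (\<Sum>A\<in>?F. z ^ d)" by simp
  also have "\<dots> \<le> (\<Sum>A\<in>?F. z ^ card A)"
    using z by (intro sum_mono power_decreasing) auto
  also have "\<dots> \<le> (\<Sum>A\<in>Pow S. z ^ card A)"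
    using S z by (intro sum_mono2) auto
  also have "\<dots> = (1 + z) ^ card S" by (rule sum_power_card_Pow[OF S])
  also have "\<dots> \<le> exp z ^ card S"
    using z by (intro power_mono) (auto simp: exp_ge_add_one_self)
  also have "\<dots> = exp (z * real (card S))" by (simp add: exp_of_nat_mult[symmetric] mult.commute)
  finally show ?thesis using z by (simp add: field_simps)
qed

definition sparse_sets :: "('a \<Rightarrow> 'a \<Rightarrow> bool) \<Rightarrow> nat \<Rightarrow> nat \<Rightarrow> 'a set \<Rightarrow> 'a set set" where
  "sparse_sets H K d S = {I. I \<subseteq> S \<and> card I \<le> d \<and> (\<forall>u\<in>I. card {w\<in>I. H u w} \<le> K)}"

lemma finite_sparse_sets: "finite S \<Longrightarrow> finite (sparse_sets H K d S)"
  unfolding sparse_sets_def by simp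

lemma sparse_sets_subset:
  assumes "I \<in> sparse_sets H K d S" "finite S" "J \<subseteq> I" "J \<subseteq> S'"
  shows "J \<in> sparse_sets H K d S'"
proof -
  have I: "I \<subseteq> S" "card I \<le> d" "\<forall>u\<in>I. card {w\<in>I. H u w} \<le> K"
    using assms(1) by (auto simp: sparse_sets_def)
  have fin: "finite I" using I(1) assms(2) by (rule finite_subset)
  have "card {w\<in>J. H u w} \<le> K" if "u \<in> J" for u
  proof -
    have "card {w\<in>J. H u w} \<le> card {w\<in>I. H u w}" using fin assms(3) by (intro card_mono) auto
    then show ?thesis using I(3) that assms(3) by fastforce
  qed
  moreover have "card J \<le> d" using card_mono[OF fin assms(3)] I(2) by simp
  ultimately show ?thesis using assms(4) by (simp add: sparse_sets_def)
qed

text \<open>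
A set that contains \<open>u\<close> is determined by the at most \<open>K\<close> elements that it has among the
\<open>H\<close>-neighbours of \<open>u\<close> and by the part of it that is outside of them.
\<close>

lemma sparse_sets_branch:
  fixes H u
  assumes S: "finite S" and u: "u \<in> S"
  defines "N \<equiv> {w\<in>S. H u w}"
  shows "card (sparse_sets H K d S)
    \<le> card (sparse_sets H K d (S - {u}))
       + (card S + 1) ^ K * card (sparse_sets H K d (S - insert u N))"
proof -
  let ?A = "{A. A \<subseteq> N \<and> card A \<le> K}"
  let ?J = "sparse_sets H K d (S - insert u N)"
  have finN: "finite N" using S by (simp add: N_def)
  have "sparse_sets H K d S
      \<subseteq> sparse_sets H K d (S - {u}) \<union> (\<lambda>(A, J). insert u A \<union> J) ` (?A \<times> ?J)"
  proof
    fix I assume I: "I \<in> sparse_sets H K d S"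
    then have IS: "I \<subseteq> S" by (simp add: sparse_sets_def)
    show "I \<in> sparse_sets H K d (S - {u}) \<union> (\<lambda>(A, J). insert u A \<union> J) ` (?A \<times> ?J)"
    proof (cases "u \<in> I")
      case False
      then have "I \<in> sparse_sets H K d (S - {u})"
        using IS by (intro sparse_sets_subset[OF I S]) auto
      then show ?thesis by simp
    next
      case True
      have "I \<inter> N = {w\<in>I. H u w}" using IS by (auto simp: N_def)
      then have "card (I \<inter> N) \<le> K" using I True by (simp add: sparse_sets_def)
      then have "I \<inter> N \<in> ?A" by simp
      moreover have "I - insert u N \<in> ?J"
        using IS by (intro sparse_sets_subset[OF I S]) auto
      moreover have "I = insert u (I \<inter> N) \<union> (I - insert u N)" using True by auto
      ultimately have "I \<in> (\<lambda>(A, J). insert u A \<union> J) ` (?A \<times> ?J)"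
        by (intro image_eqI[of _ _ "(I \<inter> N, I - insert u N)"]) auto
      then show ?thesis by simp
    qed
  qed
  then have "card (sparse_sets H K d S)
      \<le> card (sparse_sets H K d (S - {u}) \<union> (\<lambda>(A, J). insert u A \<union> J) ` (?A \<times> ?J))"
    using S finN by (intro card_mono finite_UnI finite_imageI finite_cartesian_product
      finite_sparse_sets) auto
  also have "\<dots> \<le> card (sparse_sets H K d (S - {u})) + card ((\<lambda>(A, J). insert u A \<union> J) ` (?A \<times> ?J))"
    by (rule card_Un_le)
  also have "card ((\<lambda>(A, J). insert u A \<union> J) ` (?A \<times> ?J)) \<le> card (?A \<times> ?J)"
    using S finN by (intro card_image_le finite_cartesian_product finite_sparse_sets) auto
  also have "\<dots> = card ?A * card ?J" by (rule card_cartesian_product)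
  also have "card ?A \<le> (card N + 1) ^ K" by (rule card_small_subsets[OF finN])
  also have "\<dots> \<le> (card S + 1) ^ K"
    using S by (intro power_mono add_right_mono card_mono) (auto simp: N_def)
  finally show ?thesis by simp
qed

text \<open>
The Kleitman--Winston argument. As long as more than \<open>R\<close> candidates remain, a vertex \<open>u\<close> of large
degree is tested: either it is rejected, and one candidate is lost, or it is selected, and the
candidates shrink by a factor of \<open>exp (- \<beta>)\<close>. The parameter \<open>t\<close> bounds the number of selections. The
next selected vertex and its at most \<open>K\<close> selected neighbours can be chosen in at most
\<open>(n + 1) ^ (K + 1)\<close> ways. Measuring the shrinking by \<open>exp (- \<beta>)\<close> instead of \<open>1 - \<beta>\<close> keeps the factor
positive for every \<open>\<beta>\<close>.
\<close>

lemma card_sparse_sets: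
  fixes R \<beta> B :: real
  assumes V: "finite V" "card V \<le> n" and \<beta>: "0 \<le> \<beta>"
    and dense: "\<And>S. S \<subseteq> V \<Longrightarrow> R < real (card S) \<Longrightarrow>
      \<exists>u\<in>S. \<beta> * real (card S) \<le> real (card {w\<in>S. H u w})"
    and base: "\<And>S. S \<subseteq> V \<Longrightarrow> real (card S) \<le> R \<Longrightarrow> real (card {I. I \<subseteq> S \<and> card I \<le> d}) \<le> B"
    and B: "0 \<le> B"
    and S: "S \<subseteq> V" "real (card S) * exp (- \<beta> * real t) \<le> R"
  shows "real (card (sparse_sets H K d S)) \<le> real (n + 1) ^ ((K + 1) * t) * B"
  using S
proof (induction t arbitrary: S)
  case 0
  have "finite S" using 0 V finite_subset by blast
  then have "card (sparse_sets H K d S) \<le> card {I. I \<subseteq> S \<and> card I \<le> d}"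
    by (intro card_mono) (auto simp: sparse_sets_def)
  then show ?case using base[OF 0(1)] 0(2) by simp
next
  case (Suc t)
  define M where "M = real (n + 1) ^ ((K + 1) * t) * B"
  have M0: "0 \<le> M" using B by (simp add: M_def)
  \<comment> \<open>inner induction over the rejected vertices until the next selection, which may be any of
    the \<open>card S'\<close> candidates\<close>
  have claim: "real (card (sparse_sets H K d S')) \<le> (1 + real (card S') * real (n + 1) ^ K) * M"
    if "S' \<subseteq> S" for S'
    using that
  proof (induction "card S'" arbitrary: S' rule: less_induct)
    case less
    have S'V: "S' \<subseteq> V" using less.prems Suc.prems by blast
    then have fin: "finite S'" using V(1) by (rule finite_subset)
    show ?case
    proof (cases "real (card S') \<le> R")
      case True
      have "real (card S') * exp (- \<beta> * real t) \<le> real (card S')"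
        using \<beta> by (intro mult_left_le) auto
      then have "real (card (sparse_sets H K d S')) \<le> M"
        unfolding M_def using True by (intro Suc.IH[OF S'V]) auto
      also have "\<dots> \<le> (1 + real (card S') * real (n + 1) ^ K) * M"
        using M0 by (simp add: algebra_simps)
      finally show ?thesis .
    next
      case False
      then obtain u where u: "u \<in> S'" "\<beta> * real (card S') \<le> real (card {w\<in>S'. H u w})"
        using dense[OF S'V] by auto
      let ?N = "{w\<in>S'. H u w}"
      have "card (S' - {u}) < card S'" using fin u(1) by (rule card_Diff1_less)
      then have del: "real (card (sparse_sets H K d (S' - {u})))
          \<le> (1 + real (card (S' - {u})) * real (n + 1) ^ K) * M"
        using less.prems by (intro less.hyps) auto
      have "card (S' - insert u ?N) \<le> card (S' - ?N)"
        using fin by (intro card_mono) auto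
      also have "\<dots> = card S' - card ?N" using fin by (intro card_Diff_subset) auto
      finally have "real (card (S' - insert u ?N)) \<le> real (card S') - real (card ?N)"
        using card_mono[OF fin, of ?N] by auto
      also have "\<dots> \<le> real (card S') * (1 + (- \<beta>))" using u(2) by (simp add: algebra_simps)
      also have "\<dots> \<le> real (card S') * exp (- \<beta>)"
        by (intro mult_left_mono exp_ge_add_one_self) auto
      also have "\<dots> \<le> real (card S) * exp (- \<beta>)"
        using card_mono[OF finite_subset[OF Suc.prems(1) V(1)] less.prems]
        by (intro mult_right_mono) auto
      finally have "real (card (S' - insert u ?N)) * exp (- \<beta> * real t)
          \<le> real (card S) * exp (- \<beta>) * exp (- \<beta> * real t)"
        by (intro mult_right_mono) auto
      also have "\<dots> = real (card S) * exp (- \<beta> * real (Suc t))"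
        by (simp add: exp_add[symmetric] algebra_simps)
      finally have "real (card (S' - insert u ?N)) * exp (- \<beta> * real t) \<le> R"
        using Suc.prems(2) by linarith
      then have keep: "real (card (sparse_sets H K d (S' - insert u ?N))) \<le> M"
        unfolding M_def using S'V by (intro Suc.IH) auto
      have "real (card (sparse_sets H K d S'))
          \<le> real (card (sparse_sets H K d (S' - {u})))
            + real (card S' + 1) ^ K * real (card (sparse_sets H K d (S' - insert u ?N)))"
        using of_nat_mono[OF sparse_sets_branch[OF fin u(1)], where 'a = real] by simp
      also have "\<dots> \<le> (1 + real (card (S' - {u})) * real (n + 1) ^ K) * M + real (n + 1) ^ K * M"
      proof (intro add_mono del mult_mono keep power_mono)
        show "real (card S' + 1) \<le> real (n + 1)"
          using card_mono[OF V(1) S'V] V(2) by simp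
      qed auto
      also have "\<dots> = (1 + (real (card (S' - {u})) + 1) * real (n + 1) ^ K) * M"
        by (simp add: algebra_simps)
      also have "real (card (S' - {u})) + 1 = real (card S')"
        using card.remove[OF fin u(1)] by simp
      finally show ?thesis .
    qed
  qed
  have "card S \<le> n" using card_mono[OF V(1) Suc.prems(1)] V(2) by linarith
  then have "1 + real (card S) * real (n + 1) ^ K \<le> 1 + real n * real (n + 1) ^ K"
    by (intro add_left_mono mult_right_mono) auto
  also have "\<dots> \<le> real (n + 1) ^ K + real n * real (n + 1) ^ K"
    by (intro add_right_mono one_le_power) simp
  also have "\<dots> = real (n + 1) ^ (K + 1)" by (simp add: algebra_simps)
  finally have "(1 + real (card S) * real (n + 1) ^ K) * M \<le> real (n + 1) ^ (K + 1) * M"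
    using M0 by (rule mult_right_mono)
  also have "\<dots> = real (n + 1) ^ ((K + 1) * Suc t) * B"
    by (simp only: M_def mult_Suc_right power_add mult.assoc)
  finally show ?case using claim[of S] by auto
qed

section \<open>Neighbourhoods of a new vertex\<close>

definition star :: "'a \<Rightarrow> 'a set \<Rightarrow> 'a set set" where
  "star v I = {{v, x} |x. x \<in> I}"

context fan_graph
begin

definition close :: "'a \<Rightarrow> 'a \<Rightarrow> bool" where
  "close u w \<longleftrightarrow> w \<noteq> u \<and> layer u (l - 1) \<inter> layer w (l - 1) \<noteq> {}"

text \<open>
Intersecting bottom layers: they have \<open>q ^ (l - 1)\<close> elements each and pairwise at most
\<open>l * (K + 1) * q ^ (l - 2)\<close> in common, and \<open>2 * (l - 1) - (l - 2) = l\<close> is the exponent that remains.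
\<close>

lemma close_dense:
  assumes l: "2 \<le> l" and q: "1 \<le> q" and n: "card V \<le> n" "0 < n"
    and S: "S \<subseteq> V" "2 * real n / real q ^ (l - 1) < real (card S)"
  shows "\<exists>u\<in>S. real q ^ l / (2 * real n * real l * real (K + 1)) * real (card S)
           \<le> real (card {w\<in>S. close u w})"
proof -
  define M where "M = l * (K + 1) * q ^ (l - 2)"
  have "2 * real n < real (card S) * real q ^ (l - 1)"
    using S(2) q by (simp add: field_simps)
  then have "real (2 * n) < real (card S * q ^ (l - 1))" by simp
  then have large: "2 * n \<le> card S * q ^ (l - 1)" by (simp only: of_nat_less_iff less_imp_le)
  have "\<exists>u\<in>S. real (card S) * real (q ^ (l - 1)) ^ 2
      \<le> 2 * real n * real M
        * real (card {w\<in>S. w \<noteq> u \<and> layer u (l - 1) \<inter> layer w (l - 1) \<noteq> {}})"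
  proof (rule dense_intersection_graph[OF finite_subset[OF S(1) finV] finV n _ _ _ large])
    fix u assume "u \<in> S"
    then show "layer u (l - 1) \<subseteq> V" "card (layer u (l - 1)) = q ^ (l - 1)"
      using layer[of u "l - 1"] S(1) l by auto
  next
    fix u w assume "u \<in> S" "w \<in> S" "u \<noteq> w"
    then have "card (layer u (l - 1) \<inter> layer w (l - 1)) \<le> (l - 1) * (K + 1) * q ^ (l - 1 - 1)"
      using S(1) l by (intro layer_codegree) auto
    also have "\<dots> \<le> M"
      unfolding M_def using diff_diff_left[of l 1 1] by (intro mult_mono) (auto simp: numeral_2_eq_2)
    finally show "card (layer u (l - 1) \<inter> layer w (l - 1)) \<le> M" .
  qed
  then obtain u where u: "u \<in> S"
    "real (card S) * real (q ^ (l - 1)) ^ 2 \<le> 2 * real n * real M * real (card {w\<in>S. close u w})"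
    by (auto simp: close_def)
  have "real (q ^ (l - 1)) ^ 2 = real q ^ (2 * (l - 1))" by (simp add: power_mult[symmetric] mult.commute)
  also have "2 * (l - 1) = l + (l - 2)" using l by simp
  finally have "real q ^ (l - 2) * (real (card S) * real q ^ l)
      \<le> real q ^ (l - 2) * (2 * real n * (real l * real (K + 1)) * real (card {w\<in>S. close u w}))"
    using u(2) by (simp add: M_def power_add algebra_simps)
  then have "real (card S) * real q ^ l \<le> 2 * real n * (real l * real (K + 1)) * real (card {w\<in>S. close u w})"
    using q by (subst (asm) mult_le_cancel_left_pos) auto
  then have "real q ^ l / (2 * real n * real l * real (K + 1)) * real (card S)
      \<le> real (card {w\<in>S. close u w})"
    using n l by (simp add: divide_le_eq mult.assoc) (simp add: algebra_simps)
  with u(1) show ?thesis by blast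
qed

text \<open>
If \<open>u\<close> and \<open>w\<close> are close, then the two tree paths to a common bottom vertex form a walk of length
\<open>2 * l - 2\<close> from \<open>u\<close> to \<open>w\<close> in \<open>G\<close>, hence one that avoids \<open>v\<close>. So the fan bound applies at \<open>v\<close> to the
edge \<open>vu\<close>.
\<close>

lemma neighbourhood_sparse:
  assumes v: "v \<notin> V" and I: "I \<subseteq> V" and l: "1 \<le> l"
    and ext: "fan_bounded (2 * l - 2) K (G \<union> star v I)" and u: "u \<in> I"
  shows "card {w\<in>I. close u w} \<le> K"
proof -
  let ?H = "G \<union> star v I"
  have "G \<subseteq> {e\<in>?H. v \<notin> e}" using sub v by (auto simp: edges_on_def)
  then have mono: "adj G ^^ m \<subseteq> adj {e\<in>?H. v \<notin> e} ^^ m" for m by (rule adj_relpow_mono)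
  have "{v, w} \<in> ?H \<and> w \<noteq> u \<and> (\<exists>m\<le>2 * l - 2. (u, w) \<in> adj {e\<in>?H. v \<notin> e} ^^ m)"
    if w: "w \<in> I" "close u w" for w
  proof -
    obtain x where x: "x \<in> layer u (l - 1)" "x \<in> layer w (l - 1)"
      using w(2) by (auto simp: close_def)
    have "(u, x) \<in> adj G ^^ (l - 1)" "(w, x) \<in> adj G ^^ (l - 1)"
      using x layer[of u "l - 1"] layer[of w "l - 1"] subsetD[OF I u] subsetD[OF I w(1)] l
      by (auto simp: level_def)
    then have "(u, w) \<in> adj G ^^ (l - 1 + (l - 1))"
      by (rule relpow_trans[OF _ adj_relpow_sym])
    moreover have "l - 1 + (l - 1) \<le> 2 * l - 2" by simp
    ultimately show ?thesis using mono w by (auto simp: star_def close_def)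
  qed
  moreover have "{u, v} \<in> ?H" using u by (auto simp: star_def insert_commute)
  moreover have "finite {w\<in>I. close u w}" using finite_subset[OF I finV] by simp
  ultimately show ?thesis using ext unfolding fan_bounded_def by blast
qed

text \<open>
The assumption on \<open>t\<close> says that \<open>t\<close> is at least \<open>ln n / \<beta>\<close>, so that \<open>t\<close> selections would leave at most
one candidate. The parameter \<open>z\<close> is the weight in the count of the small subsets of the candidates
that remain at the end; it will be chosen according to \<open>d\<close>.
\<close>

lemma card_extensions:
  fixes z :: real
  assumes l: "2 \<le> l" and q: "1 \<le> q" and n: "card V \<le> n" "0 < n" and v: "v \<notin> V"
    and z: "0 < z" "z \<le> 1"
    and t: "ln (real n) * (2 * real n * real l * real (K + 1)) \<le> real q ^ l * real t"
  shows "real (card {I. I \<subseteq> V \<and> card I \<le> d \<and> fan_bounded (2 * l - 2) K (G \<union> star v I)})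
    \<le> real (n + 1) ^ ((K + 1) * t) * ((1 / z) ^ d * exp (z * (2 * real n / real q ^ (l - 1))))"
proof -
  define R where "R = 2 * real n / real q ^ (l - 1)"
  define \<beta> where "\<beta> = real q ^ l / (2 * real n * real l * real (K + 1))"
  have "{I. I \<subseteq> V \<and> card I \<le> d \<and> fan_bounded (2 * l - 2) K (G \<union> star v I)} \<subseteq> sparse_sets close K d V"
    using neighbourhood_sparse[OF v] l by (auto simp: sparse_sets_def)
  then have "card {I. I \<subseteq> V \<and> card I \<le> d \<and> fan_bounded (2 * l - 2) K (G \<union> star v I)}
      \<le> card (sparse_sets close K d V)"
    by (intro card_mono finite_sparse_sets finV)
  also have "real (card (sparse_sets close K d V))
      \<le> real (n + 1) ^ ((K + 1) * t) * ((1 / z) ^ d * exp (z * R))"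
  proof (rule card_sparse_sets[OF finV n(1), where R = R and \<beta> = \<beta>])
    show "0 \<le> \<beta>" by (simp add: \<beta>_def)
    show "\<exists>u\<in>S. \<beta> * real (card S) \<le> real (card {w \<in> S. close u w})"
      if "S \<subseteq> V" "R < real (card S)" for S
      using close_dense[OF l q n that(1)] that(2) by (simp add: R_def \<beta>_def)
    show "real (card {I. I \<subseteq> S \<and> card I \<le> d}) \<le> (1 / z) ^ d * exp (z * R)"
      if S: "S \<subseteq> V" "real (card S) \<le> R" for S
    proof -
      have "real (card {I. I \<subseteq> S \<and> card I \<le> d}) \<le> (1 / z) ^ d * exp (z * real (card S))"
        by (rule card_small_subsets_exp[OF finite_subset[OF S(1) finV] z])
      also have "\<dots> \<le> (1 / z) ^ d * exp (z * R)" using S(2) z by (intro mult_left_mono) auto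
      finally show ?thesis .
    qed
    show "0 \<le> (1 / z) ^ d * exp (z * R)" using z by simp
    show "real (card V) * exp (- \<beta> * real t) \<le> R"
    proof (cases "V = {}")
      case False
      then obtain u where u: "u \<in> V" by blast
      have "q ^ (l - 1) \<le> card V"
        using layer[OF u, of "l - 1"] l card_mono[OF finV, of "layer u (l - 1)"] by auto
      then have "real (q ^ (l - 1)) \<le> real n" using n(1) by (intro of_nat_mono) linarith
      then have "real q ^ (l - 1) \<le> 2 * real n" unfolding of_nat_power by linarith
      then have "1 \<le> R" using q by (simp add: R_def)
      have "ln (real n) \<le> real q ^ l * real t / (2 * real n * real l * real (K + 1))"
        using t n(2) l by (subst pos_le_divide_eq) auto
      then have "ln (real n) \<le> \<beta> * real t" by (simp add: \<beta>_def)
      then have "exp (ln (real n)) \<le> exp (\<beta> * real t)" by simp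
      then have "real n \<le> exp (\<beta> * real t)" using n(2) by simp
      then have "real n * exp (- \<beta> * real t) \<le> 1" by (simp add: exp_minus field_simps)
      moreover have "real (card V) * exp (- \<beta> * real t) \<le> real n * exp (- \<beta> * real t)"
        using n(1) by (intro mult_right_mono) auto
      ultimately show ?thesis using \<open>1 \<le> R\<close> by linarith
    qed (use R_def in simp)
  qed simp
  finally show ?thesis by (simp only: R_def of_nat_le_iff)
qed

end

section \<open>Asymptotic estimates\<close>

text \<open>
The three senses in which \<open>n\<close> has to be large: the first makes every \<open>d > N / c\<close> large compared with
\<open>K\<close>, the second pays for the choices made while candidates are being excluded, and the third pays for
the choice of the removed vertex and its degree.
\<close>

lemma eventually_polylog_le:
  fixes l K :: nat
  assumes "l \<ge> 1"
  defines "c \<equiv> \<lambda>n. log 2 (real n + 1)" and "N \<equiv> \<lambda>n. real n powr (1 / real l)"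
  shows "\<forall>\<^sub>F n in sequentially. 2 * real l * real (K + 2) * c n \<le> N n"
    and "\<forall>\<^sub>F n in sequentially.
           c n * (real (K + 1) * (4 * real l * real (K + 1) * c n ^ (l + 1) + 1)) \<le> N n"
    and "\<forall>\<^sub>F n in sequentially. 2 * c n \<le> N n"
proof -
  have pos: "1 / real l > 0" using assms by simp
  have lim: "((\<lambda>n. c n ^ m / N n) \<longlongrightarrow> 0) sequentially" for m
    unfolding c_def N_def using pos by real_asymp
  have *: "\<forall>\<^sub>F n in sequentially. a * c n ^ m \<le> N n / 2" if "a > 0" for a m
  proof -
    have "\<forall>\<^sub>F n in sequentially. c n ^ m / N n < 1 / (2 * a)"
      using lim[of m] that by (intro order_tendstoD(2)) auto
    then show ?thesis using eventually_gt_at_top[of 0]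
    proof eventually_elim
      case (elim n)
      then have "N n > 0" by (simp add: N_def)
      with elim that show ?case by (simp add: field_simps)
    qed
  qed
  have N0: "0 \<le> N n" for n by (simp add: N_def)
  have "0 < 2 * real l * real (K + 2)" using assms(1) by simp
  from *[OF this, of 1]
  show "\<forall>\<^sub>F n in sequentially. 2 * real l * real (K + 2) * c n \<le> N n"
  proof eventually_elim
    case (elim n)
    with N0[of n] show ?case unfolding power_one_right by linarith
  qed
  show "\<forall>\<^sub>F n in sequentially. 2 * c n \<le> N n"
  proof -
    have "\<forall>\<^sub>F n in sequentially. 2 * c n ^ 1 \<le> N n / 2" using *[of 2 1] by simp
    then show ?thesis
    proof eventually_elim
      case (elim n)
      with N0[of n] show ?case by simp
    qed
  qed
  have "0 < real (K + 1) * (4 * real l * real (K + 1))" using assms(1) by simp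
  moreover have "0 < real (K + 1)" by simp
  ultimately have "\<forall>\<^sub>F n in sequentially.
      real (K + 1) * (4 * real l * real (K + 1)) * c n ^ (l + 2) \<le> N n / 2"
    "\<forall>\<^sub>F n in sequentially. real (K + 1) * c n ^ 1 \<le> N n / 2" by (blast intro: *)+
  then
  show "\<forall>\<^sub>F n in sequentially.
      c n * (real (K + 1) * (4 * real l * real (K + 1) * c n ^ (l + 1) + 1)) \<le> N n"
  proof eventually_elim
    case (elim n)
    have "c n * (real (K + 1) * (4 * real l * real (K + 1) * c n ^ (l + 1) + 1))
        = real (K + 1) * (4 * real l * real (K + 1)) * c n ^ (l + 2) + real (K + 1) * c n ^ 1"
      by (simp add: algebra_simps)
    with elim show ?case by simp
  qed
qed

text \<open>
Bernoulli's inequality: replacing \<open>d\<close> by \<open>d - a\<close> costs at most a factor of two in a \<open>k\<close>-th power once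
\<open>d \<ge> 2 * l * a\<close>. This is what keeps \<open>K\<close> out of the leading term.
\<close>

lemma power_shift_ge_half:
  assumes "2 * real l * real a \<le> real d" "q + a = d" "k \<le> l" "1 \<le> l" "1 \<le> a"
  shows "real d ^ k \<le> 2 * real q ^ k"
proof -
  define x where "x = real a / real d"
  have d: "real d > 0" using assms by (cases "d = 0") auto
  have lx: "real l * x \<le> 1 / 2" using assms(1) d by (simp add: x_def field_simps)
  have x0: "0 \<le> x" by (simp add: x_def)
  have "real k * x \<le> real l * x" using assms(3) x0 by (intro mult_right_mono) auto
  with lx have kx: "real k * x \<le> 1 / 2" by linarith
  have "x \<le> real l * x" using assms(4) x0 by (cases l) (auto simp: algebra_simps)
  with lx have x1: "x \<le> 1" by linarith
  have "1 / 2 \<le> 1 + real k * (- x)" using kx by simp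
  also have "\<dots> \<le> (1 + (- x)) ^ k" using x1 by (intro Bernoulli_inequality) auto
  also have "1 + (- x) = real q / real d" using d assms(2) by (simp add: x_def field_simps)
  finally show ?thesis using d by (simp add: power_divide field_simps)
qed

text \<open>
With \<open>4 * n / d ^ (l - 1)\<close> candidates left, the best weight is about \<open>z = d ^ l / n\<close>, capped at one. For
\<open>d \<ge> N\<close> all subsets are counted, and at most \<open>4 * N\<close> candidates are left. For \<open>d < N\<close> the exponential
factor is \<open>exp (4 * d)\<close>, and \<open>(1 / z) ^ d\<close> equals \<open>(N / d) ^ (l * d)\<close>, which is at most
\<open>2 powr (l * N)\<close> because \<open>y \<le> 2 powr y\<close> for \<open>y = N / d\<close>.
\<close>

lemma stopping_set_bound:
  fixes l d :: nat and n :: nat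
  assumes l: "3 \<le> l" and n: "0 < n" and d: "0 < d"
  defines "N \<equiv> real n powr (1 / real l)"
  shows "\<exists>z. 0 < z \<and> z \<le> 1 \<and>
    (1 / z) ^ d * exp (z * (4 * real n / real d ^ (l - 1))) \<le> 2 powr ((real l + 6) * N)"
proof -
  have N: "0 < N" using n by (simp add: N_def)
  have Nl: "N ^ l = real n" using n l by (simp add: N_def powr_realpow[symmetric] powr_powr)
  have split: "y ^ l = y * y ^ (l - 1)" for y :: real using l by (cases l) auto
  have exp4: "exp (4 * y) \<le> 2 powr (6 * y)" if "0 \<le> y" for y :: real
  proof -
    \<comment> \<open>the origin of the constant \<open>6\<close>: four natural units of information are less than six bits\<close>
    have "4 \<le> 6 * ln (2::real)" using ln2_ge_two_thirds by simp
    then have "4 * y \<le> (6 * ln 2) * y" using that by (rule mult_right_mono)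
    then show ?thesis by (simp add: powr_def mult.assoc mult.left_commute)
  qed
  show ?thesis
  proof (cases "N \<le> real d")
    case True
    have "real n \<le> N * real d ^ (l - 1)"
      unfolding Nl[symmetric] split using N True by (intro mult_left_mono power_mono) auto
    then have "4 * real n / real d ^ (l - 1) \<le> 4 * N" using d by (simp add: field_simps)
    then have "exp (4 * real n / real d ^ (l - 1)) \<le> exp (4 * N)" by simp
    also have "\<dots> \<le> 2 powr (6 * N)" using N by (intro exp4) simp
    also have "\<dots> \<le> 2 powr ((real l + 6) * N)" using N by (intro powr_mono) (auto simp: algebra_simps)
    finally show ?thesis by (intro exI[of _ 1]) simp
  next
    case False
    \<comment> \<open>up to a constant, \<open>z\<close> is the proportion of the remaining candidates that is to be chosen\<close>
    define z where "z = real d ^ l / real n"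
    have z0: "0 < z" using n d by (simp add: z_def)
    have "real d ^ l \<le> N ^ l" using False by (intro power_mono) auto
    then have z1: "z \<le> 1" using n by (simp add: z_def Nl)
    have "1 / z = (N / real d) ^ l" using d by (simp add: z_def Nl[symmetric] power_divide)
    also have "\<dots> \<le> (2 powr (N / real d)) ^ l"
    proof (intro power_mono)
      have "1 + (N / real d * ln 2 - 1) \<le> exp (N / real d * ln 2 - 1)" by (rule exp_ge_add_one_self)
      then have "N / real d * (ln 2 * exp 1) \<le> exp (N / real d * ln 2)"
        by (simp add: exp_diff field_simps)
      moreover have "1 \<le> ln 2 * exp (1::real)"
      proof -
        have "2 \<le> exp (1::real)" using exp_ge_add_one_self[of 1] by simp
        then have "2 / 3 * 2 \<le> ln 2 * exp (1::real)"
          using ln2_ge_two_thirds by (intro mult_mono) auto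
        then show ?thesis by simp
      qed
      then have "N / real d * 1 \<le> N / real d * (ln 2 * exp 1)"
        using N by (intro mult_left_mono) auto
      ultimately have "N / real d \<le> exp (N / real d * ln 2)" by linarith
      then show "N / real d \<le> 2 powr (N / real d)" by (simp add: powr_def)
    qed (use N in simp)
    finally have "(1 / z) ^ d \<le> ((2 powr (N / real d)) ^ l) ^ d"
      using z0 by (intro power_mono) auto
    also have "\<dots> = 2 powr (real l * N)"
      using d by (simp add: powr_realpow[symmetric] powr_powr mult.commute)
    finally have left: "(1 / z) ^ d \<le> 2 powr (real l * N)" .
    have "z * (4 * real n / real d ^ (l - 1)) = 4 * real d"
      using n d by (simp add: z_def split)
    then have "exp (z * (4 * real n / real d ^ (l - 1))) \<le> 2 powr (6 * real d)"
      using exp4[of "real d"] by simp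
    also have "\<dots> \<le> 2 powr (6 * N)" using False by (intro powr_mono) auto
    finally have "(1 / z) ^ d * exp (z * (4 * real n / real d ^ (l - 1)))
        \<le> 2 powr (real l * N) * 2 powr (6 * N)"
      using left z0 by (intro mult_mono) auto
    also have "\<dots> = 2 powr ((real l + 6) * N)" by (simp add: powr_add[symmetric] algebra_simps)
    finally show ?thesis using z0 z1 by blast
  qed
qed

text \<open>
Once \<open>d\<close> exceeds \<open>N / c\<close>, the ratio \<open>n / d ^ l\<close> is at most \<open>c ^ l\<close>, so polylogarithmically many
selections suffice, at a cost of \<open>c * (K + 1)\<close> bits for each.
\<close>

lemma selection_rounds_bound:
  fixes l K n d :: nat
  assumes l: "1 \<le> l" and n: "0 < n" and d: "0 < d"
  defines "c \<equiv> log 2 (real n + 1)" and "N \<equiv> real n powr (1 / real l)"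
  assumes large: "N < real d * c"
    and rounds: "c * (real (K + 1) * (4 * real l * real (K + 1) * c ^ (l + 1) + 1)) \<le> N"
  shows "\<exists>t. ln (real n) * (4 * real n * real l * real (K + 1)) \<le> real d ^ l * real t \<and>
    real (n + 1) ^ ((K + 1) * t) \<le> 2 powr N"
proof -
  define y where "y = ln (real n) * (4 * real n * real l * real (K + 1)) / real d ^ l"
  define t where "t = nat \<lceil>y\<rceil>"
  have N: "0 < N" using n by (simp add: N_def)
  have Nl: "N ^ l = real n" using n l by (simp add: N_def powr_realpow[symmetric] powr_powr)
  have c0: "0 < c" using n by (simp add: c_def)
  have ln_c: "ln (real n) \<le> c"
  proof -
    have "ln (real n) \<le> ln (real n + 1)" using n by simp
    also have "\<dots> \<le> ln (real n + 1) / ln 2"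
      using n ln_2_less_1 by (simp add: le_divide_eq mult_left_le)
    finally show ?thesis by (simp add: c_def log_def)
  qed
  have y0: "0 \<le> y" using n by (simp add: y_def)
  have "real n \<le> (real d * c) ^ l" unfolding Nl[symmetric] using N large by (intro power_mono) auto
  then have nd: "real n / real d ^ l \<le> c ^ l" using d by (simp add: field_simps power_mult_distrib)
  have "y = (4 * real l * real (K + 1)) * (ln (real n) * (real n / real d ^ l))"
    by (simp add: y_def)
  also have "\<dots> \<le> (4 * real l * real (K + 1)) * (c * c ^ l)"
    using ln_c nd n c0 by (intro mult_left_mono mult_mono) auto
  finally have "y \<le> 4 * real l * real (K + 1) * c ^ (l + 1)" by simp
  moreover have "real t \<le> y + 1" unfolding t_def using y0 by linarith
  ultimately have "real t \<le> 4 * real l * real (K + 1) * c ^ (l + 1) + 1" by linarith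
  then have "c * (real (K + 1) * real t)
      \<le> c * (real (K + 1) * (4 * real l * real (K + 1) * c ^ (l + 1) + 1))"
    using c0 by (intro mult_left_mono) auto
  then have ct: "c * (real (K + 1) * real t) \<le> N" using rounds by linarith
  have "real (n + 1) = 2 powr c" by (simp add: c_def add.commute)
  then have "real (n + 1) ^ ((K + 1) * t) = 2 powr (c * real ((K + 1) * t))"
    by (simp only: powr_realpow[symmetric] powr_powr powr_gt_zero)
  also have "\<dots> \<le> 2 powr N"
  proof (intro powr_mono)
    show "c * real ((K + 1) * t) \<le> N" using ct by (simp only: of_nat_mult)
  qed simp
  finally have "real (n + 1) ^ ((K + 1) * t) \<le> 2 powr N" .
  moreover have "ln (real n) * (4 * real n * real l * real (K + 1)) \<le> real d ^ l * real t"
  proof -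
    have "y \<le> real t" unfolding t_def by (rule real_nat_ceiling_ge)
    then show ?thesis using d by (simp add: y_def field_simps)
  qed
  ultimately show ?thesis by blast
qed

text \<open>
With \<open>N\<close> for \<open>n\<close> to the power \<open>1 / l\<close>, values of \<open>d\<close> up to \<open>N / log 2 (n + 1)\<close> are covered by the
trivial count. Above that the bounds on selections
and on the remaining candidates multiply to \<open>2 powr ((l + 7) * N)\<close>, and \<open>l + 7 \<le> 3 * l + 1\<close>
is where \<open>l \<ge> 3\<close> is used.
\<close>

lemma extensions_bound:
  fixes l K :: nat
  assumes l: "3 \<le> l"
  shows "\<forall>\<^sub>F n in sequentially. \<forall>(V::'a set) G d v.
    finite V \<and> card V \<le> n \<and> G \<subseteq> edges_on V \<and> fan_bounded (2 * l - 2) K G \<and> v \<notin> V \<and>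
    (\<forall>x\<in>V. d \<le> card (nbrs G x) + 1) \<longrightarrow>
    real (card {I. I \<subseteq> V \<and> card I \<le> d \<and> fan_bounded (2 * l - 2) K (G \<union> star v I)})
      \<le> 2 powr ((3 * real l + 1) * real n powr (1 / real l))"
proof -
  have "1 \<le> l" using l by simp
  from eventually_polylog_le(1,2)[OF this, of K] eventually_gt_at_top[of 0]
  show ?thesis
  proof eventually_elim
    case (elim n)
    define N where "N = real n powr (1 / real l)"
    define c where "c = log 2 (real n + 1)"
    have n: "0 < n" using elim by simp
    have big: "2 * real l * real (K + 2) * c \<le> N"
      "c * (real (K + 1) * (4 * real l * real (K + 1) * c ^ (l + 1) + 1)) \<le> N"
      using elim l by (simp_all add: N_def c_def)
    have N: "0 < N" and c: "0 < c" using n by (simp_all add: N_def c_def)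
    show ?case
    proof (intro allI impI, elim conjE)
      fix V :: "'a set" and G d v
      assume V: "finite V" "card V \<le> n" and G: "G \<subseteq> edges_on V" "fan_bounded (2 * l - 2) K G"
        and v: "v \<notin> V" and deg: "\<forall>x\<in>V. d \<le> card (nbrs G x) + 1"
      let ?E = "{I. I \<subseteq> V \<and> card I \<le> d \<and> fan_bounded (2 * l - 2) K (G \<union> star v I)}"
      show "real (card ?E) \<le> 2 powr ((3 * real l + 1) * real n powr (1 / real l))"
      proof (cases "real d * c \<le> N")
        case True
        have "card ?E \<le> card {I. I \<subseteq> V \<and> card I \<le> d}" using V(1) by (intro card_mono) auto
        also have "\<dots> \<le> (card V + 1) ^ d" by (rule card_small_subsets[OF V(1)])
        also have "\<dots> \<le> (n + 1) ^ d" using V(2) by (intro power_mono) auto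
        finally have "real (card ?E) \<le> real ((n + 1) ^ d)" by (rule of_nat_mono)
        then have "real (card ?E) \<le> real (n + 1) ^ d" unfolding of_nat_power .
        also have "real (n + 1) = 2 powr c" by (simp add: c_def add.commute)
        also have "(2 powr c) ^ d = 2 powr (c * real d)" by (simp add: powr_realpow[symmetric] powr_powr)
        also have "\<dots> \<le> 2 powr ((3 * real l + 1) * N)"
        proof (intro powr_mono)
          have "c * real d \<le> N" using True by (simp add: mult.commute)
          also have "\<dots> \<le> (3 * real l + 1) * N" using N by (simp add: algebra_simps)
          finally show "c * real d \<le> (3 * real l + 1) * N" .
        qed simp
        finally show ?thesis by (simp only: N_def)
      next
        case False
        have "2 * real l * real (K + 2) * c < real d * c" using False big(1) by linarith
        then have dK: "2 * real l * real (K + 2) \<le> real d" using c by simp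
        have "2 * real (K + 2) \<le> 2 * real l * real (K + 2)" using l by (intro mult_right_mono) auto
        then have "2 * (K + 2) \<le> d" using dK by linarith
        \<comment> \<open>old degrees are at least \<open>d - 1\<close>, and \<open>K + 1\<close> of the neighbours may fail to be children\<close>
      define q where "q = d - (K + 2)"
        have q: "q + (K + 2) = d" "1 \<le> q" using \<open>2 * (K + 2) \<le> d\<close> by (simp_all add: q_def)
        have half: "real d ^ k \<le> 2 * real q ^ k" if "k \<le> l" for k
          by (rule power_shift_ge_half[OF dK q(1) that]) (use l in auto)
        have d0: "0 < d" using q by simp
        interpret fan_graph V G l K q
          using V G deg q by unfold_locales auto
        obtain t where t: "ln (real n) * (4 * real n * real l * real (K + 1)) \<le> real d ^ l * real t"
          "real (n + 1) ^ ((K + 1) * t) \<le> 2 powr N"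
          using selection_rounds_bound[of l n d K] big(2) False l n d0 by (auto simp: N_def c_def)
        obtain z where z: "0 < z" "z \<le> 1"
          "(1 / z) ^ d * exp (z * (4 * real n / real d ^ (l - 1))) \<le> 2 powr ((real l + 6) * N)"
          using stopping_set_bound[OF l n d0] by (auto simp: N_def)
        have "real d ^ l * real t \<le> 2 * real q ^ l * real t" using half[of l] by (intro mult_right_mono) auto
        then have tq: "ln (real n) * (2 * real n * real l * real (K + 1)) \<le> real q ^ l * real t"
          using t(1) by simp
        have "2 * real n / real q ^ (l - 1) \<le> 4 * real n / real d ^ (l - 1)"
        proof -
          have "2 * real n * real d ^ (l - 1) \<le> 2 * real n * (2 * real q ^ (l - 1))"
            using half[of "l - 1"] by (intro mult_left_mono) auto
          then show ?thesis using d0 q(2) by (simp add: field_simps)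
        qed
        then have "z * (2 * real n / real q ^ (l - 1)) \<le> z * (4 * real n / real d ^ (l - 1))"
          using z(1) by (rule mult_left_mono[OF _ less_imp_le])
        then have "exp (z * (2 * real n / real q ^ (l - 1))) \<le> exp (z * (4 * real n / real d ^ (l - 1)))"
          by (simp only: exp_le_cancel_iff)
        then have "(1 / z) ^ d * exp (z * (2 * real n / real q ^ (l - 1))) \<le> 2 powr ((real l + 6) * N)"
          using z by (intro order_trans[OF mult_left_mono z(3)]) auto
        then have "real (n + 1) ^ ((K + 1) * t) * ((1 / z) ^ d * exp (z * (2 * real n / real q ^ (l - 1))))
            \<le> 2 powr N * 2 powr ((real l + 6) * N)"
          using t(2) z by (intro mult_mono) auto
        also have "\<dots> = 2 powr ((real l + 7) * N)" by (simp add: powr_add[symmetric] algebra_simps)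
        also have "\<dots> \<le> 2 powr ((3 * real l + 1) * N)" using N l by (intro powr_mono mult_right_mono) auto
        finally have "real (n + 1) ^ ((K + 1) * t) * ((1 / z) ^ d * exp (z * (2 * real n / real q ^ (l - 1))))
            \<le> 2 powr ((3 * real l + 1) * N)" .
        with card_extensions[OF _ q(2) V(2) n v z(1,2) tq, of d] l show ?thesis
          unfolding N_def by linarith
      qed
    qed
  qed
qed

section \<open>Peeling off vertices of minimum degree\<close>

lemma card_UN_le_real:
  fixes M :: real
  assumes "finite A" "\<And>a. a \<in> A \<Longrightarrow> real (card (F a)) \<le> M"
  shows "real (card (\<Union>a\<in>A. F a)) \<le> real (card A) * M"
proof -
  have "real (card (\<Union>a\<in>A. F a)) \<le> (\<Sum>a\<in>A. real (card (F a)))"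
    using of_nat_mono[OF card_UN_le[OF assms(1)], where 'a = real, of F] by simp
  also have "\<dots> \<le> real (card A) * M" by (rule sum_bounded_above[OF assms(2)])
  finally show ?thesis .
qed

text \<open>
Removing a vertex \<open>v\<close> of minimum degree \<open>d\<close> lowers every other degree by at most one, so the
neighbourhood of \<open>v\<close> is one of the sets counted by \<open>ext\<close>. The factor \<open>n * n\<close> pays for the choices of
\<open>v\<close> and \<open>d\<close>.
\<close>

lemma card_fan_bounded_graphs:
  fixes M :: real and V :: "'a set"
  assumes M: "0 \<le> M"
    and ext: "\<And>(V::'a set) G d v.
      finite V \<Longrightarrow> card V \<le> n \<Longrightarrow> G \<subseteq> edges_on V \<Longrightarrow> fan_bounded r K G \<Longrightarrow> v \<notin> V \<Longrightarrow>
      (\<forall>x\<in>V. d \<le> card (nbrs G x) + 1) \<Longrightarrow>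
      real (card {I. I \<subseteq> V \<and> card I \<le> d \<and> fan_bounded r K (G \<union> star v I)}) \<le> M"
    and V: "finite V" "card V \<le> n"
  shows "real (card {G. G \<subseteq> edges_on V \<and> fan_bounded r K G}) \<le> (real n * real n * M) ^ card V"
  using V
proof (induction "card V" arbitrary: V)
  case 0
  then have "edges_on V = {}" by (auto simp: edges_on_def)
  then have "{G. G \<subseteq> edges_on V \<and> fan_bounded r K G} \<subseteq> {{}}" by auto
  from card_mono[OF _ this] show ?case using 0 by simp
next
  case (Suc m)
  define \<F> where "\<F> W = {G. G \<subseteq> edges_on W \<and> fan_bounded r K G}" for W :: "'a set"
  define \<E> where "\<E> W G d v = {I. I \<subseteq> W \<and> card I \<le> d \<and> fan_bounded r K (G \<union> star v I)}"
    for W :: "'a set" and G d v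
  define \<D> where "\<D> W d = {G \<in> \<F> W. \<forall>x\<in>W. d \<le> card (nbrs G x) + 1}" for W :: "'a set" and d
  define P where "P = (real n * real n * M) ^ m"
  have fin\<F>: "finite (\<F> W)" if "finite W" for W
    using finite_edges_on[OF that] by (simp add: \<F>_def)
  have peel: "\<F> V \<subseteq> (\<Union>v\<in>V. \<Union>d\<in>{..<card V}. \<Union>G\<in>\<D> (V - {v}) d.
      (\<lambda>I. G \<union> star v I) ` \<E> (V - {v}) G d v)"
  proof
    fix G assume "G \<in> \<F> V"
    then have G: "G \<subseteq> edges_on V" "fan_bounded r K G" by (auto simp: \<F>_def)
    have ne: "V \<noteq> {}" using Suc.hyps by auto
    define v where "v = arg_min_on (\<lambda>x. card (nbrs G x)) V"
    have v: "v \<in> V" "\<And>x. x \<in> V \<Longrightarrow> card (nbrs G v) \<le> card (nbrs G x)"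
      unfolding v_def using arg_min_if_finite(1)[OF Suc.prems(1) ne]
        arg_min_least[OF Suc.prems(1) ne, of _ "\<lambda>x. card (nbrs G x)"] by simp_all
    define G' where "G' = {e\<in>G. v \<notin> e}"
    define I where "I = nbrs G v"
    have fin_nbrs: "finite (nbrs G x)" for x
      by (rule finite_subset[OF _ Suc.prems(1)]) (use edges_on_mem[OF G(1)] in \<open>auto simp: nbrs_def\<close>)
    have IV: "I \<subseteq> V - {v}"
      using edges_on_mem[OF G(1)] edges_on_noloop[OF G(1)] unfolding I_def nbrs_def by blast
    have G'V: "G' \<subseteq> edges_on (V - {v})"
      using G(1) unfolding G'_def edges_on_def by blast
    have GI: "G = G' \<union> star v I"
    proof
      show "G \<subseteq> G' \<union> star v I"
      proof
        fix e assume e: "e \<in> G"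
        then obtain a b where "e = {a, b}" using G(1) by (auto simp: edges_on_def)
        then show "e \<in> G' \<union> star v I"
          using e by (auto simp: G'_def star_def I_def nbrs_def insert_commute)
      qed
    qed (auto simp: G'_def star_def I_def nbrs_def)
    have "card I \<le> card (V - {v})" using IV Suc.prems(1) by (intro card_mono) auto
    then have dlt: "card I < card V" using v(1) Suc.prems(1) Suc.hyps(2) by simp
    have "card I \<le> card (nbrs G' x) + 1" if "x \<in> V - {v}" for x
    proof -
      have "nbrs G x \<subseteq> insert v (nbrs G' x)" using that by (auto simp: nbrs_def G'_def)
      moreover have "finite (nbrs G' x)" 
        by (rule finite_subset[OF _ fin_nbrs[of x]]) (auto simp: nbrs_def G'_def)
      ultimately have "card (nbrs G x) \<le> card (insert v (nbrs G' x))" by (intro card_mono) auto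
      also have "\<dots> \<le> card (nbrs G' x) + 1"
        using \<open>finite (nbrs G' x)\<close> by (simp add: card_insert_if)
      finally show ?thesis using v(2)[of x] that by (simp add: I_def)
    qed
    then have "G' \<in> \<D> (V - {v}) (card I)"
      using G'V fan_bounded_mono[OF G(2), of G'] by (auto simp: \<D>_def \<F>_def G'_def)
    moreover have "I \<in> \<E> (V - {v}) G' (card I) v" using IV G(2) GI by (simp add: \<E>_def)
    ultimately show "G \<in> (\<Union>v\<in>V. \<Union>d\<in>{..<card V}. \<Union>G\<in>\<D> (V - {v}) d.
        (\<lambda>I. G \<union> star v I) ` \<E> (V - {v}) G d v)"
      using v(1) dlt GI by blast
  qed
  have fin\<D>: "finite (\<D> (V - {v}) d)" for v d using fin\<F>[of "V - {v}"] Suc.prems(1) by (simp add: \<D>_def)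
  have fin\<E>: "finite (\<E> (V - {v}) G d v)" for v G d using Suc.prems(1) by (simp add: \<E>_def)
  have cn: "real (card V) \<le> real n" using Suc.prems(2) by simp
  have P0: "0 \<le> P" using M by (simp add: P_def)
  have "card (\<F> V) \<le> card (\<Union>v\<in>V. \<Union>d\<in>{..<card V}. \<Union>G\<in>\<D> (V - {v}) d.
      (\<lambda>I. G \<union> star v I) ` \<E> (V - {v}) G d v)"
    using fin\<D> fin\<E> Suc.prems(1) by (intro card_mono peel) auto
  then have "real (card (\<F> V)) \<le> real (card (\<Union>v\<in>V. \<Union>d\<in>{..<card V}. \<Union>G\<in>\<D> (V - {v}) d.
      (\<lambda>I. G \<union> star v I) ` \<E> (V - {v}) G d v))" by (rule of_nat_mono)
  also have "\<dots> \<le> real (card V) * (real (card {..<card V}) * (P * M))"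
  proof (intro card_UN_le_real Suc.prems(1) finite_lessThan)
    fix v d assume v: "v \<in> V" and "d \<in> {..<card V}"
    have cV: "m = card (V - {v})" "card (V - {v}) \<le> n" using Suc v by simp_all
    have "real (card (\<Union>G\<in>\<D> (V - {v}) d. (\<lambda>I. G \<union> star v I) ` \<E> (V - {v}) G d v))
        \<le> real (card (\<D> (V - {v}) d)) * M"
    proof (rule card_UN_le_real[OF fin\<D>])
      fix G assume G: "G \<in> \<D> (V - {v}) d"
      have "card ((\<lambda>I. G \<union> star v I) ` \<E> (V - {v}) G d v) \<le> card (\<E> (V - {v}) G d v)"
        by (rule card_image_le[OF fin\<E>])
      also have "real (card (\<E> (V - {v}) G d v)) \<le> M"
        unfolding \<E>_def using G cV(2) Suc.prems(1) by (intro ext) (auto simp: \<D>_def \<F>_def)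
      finally show "real (card ((\<lambda>I. G \<union> star v I) ` \<E> (V - {v}) G d v)) \<le> M"
        by (simp only: of_nat_le_iff)
    qed
    also have "\<dots> \<le> P * M"
    proof (rule mult_right_mono[OF _ M])
      have "card (\<D> (V - {v}) d) \<le> card (\<F> (V - {v}))"
        using fin\<F> Suc.prems(1) by (intro card_mono) (auto simp: \<D>_def)
      moreover have "real (card (\<F> (V - {v}))) \<le> P"
        unfolding \<F>_def P_def using Suc.hyps(1)[OF cV(1)] cV Suc.prems(1) by simp
      ultimately show "real (card (\<D> (V - {v}) d)) \<le> P" by linarith
    qed
    finally show "real (card (\<Union>G\<in>\<D> (V - {v}) d. (\<lambda>I. G \<union> star v I) ` \<E> (V - {v}) G d v))
        \<le> P * M" .
  qed
  also have "\<dots> \<le> real n * (real n * (P * M))"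
    using cn P0 M by (intro mult_mono) auto
  also have "\<dots> = (real n * real n * M) ^ Suc m" by (simp add: P_def)
  finally show ?case using Suc.hyps(2) by (simp add: \<F>_def)
qed

theorem theorem1p5:
  fixes l :: nat and L :: real
  assumes "l \<ge> 3" and "L > 0"
  shows "\<exists>n\<^sub>0::nat. \<forall>n\<ge>n\<^sub>0.
           real (card (few_cycle_graphs n (2 * l) L))
             \<le> 2 powr (3 * (real l + 1) * real n powr (1 + 1 / real l))"
proof -
  define K where "K = nat \<lceil>4 * real l ^ 2 * L\<rceil>"
  have K: "4 * real l ^ 2 * L \<le> real K" unfolding K_def by (rule real_nat_ceiling_ge)
  have "l \<ge> 1" using assms(1) by simp
  have "\<forall>\<^sub>F n in sequentially. real (card (few_cycle_graphs n (2 * l) L))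
      \<le> 2 powr (3 * (real l + 1) * real n powr (1 + 1 / real l))"
    using extensions_bound[OF assms(1), of K, where 'a = nat] eventually_polylog_le(3)[OF \<open>l \<ge> 1\<close>]
      eventually_gt_at_top[of 0]
  proof eventually_elim
    case (elim n)
    define N where "N = real n powr (1 / real l)"
    define M where "M = 2 powr ((3 * real l + 1) * N)"
    have n: "0 < n" using elim by simp
    have "card (few_cycle_graphs n (2 * l) L)
        \<le> card {G. G \<subseteq> edges_on {1..n} \<and> fan_bounded (2 * l - 2) K G}"
    proof (rule card_mono)
      show "finite {G. G \<subseteq> edges_on {1..n} \<and> fan_bounded (2 * l - 2) K G}"
        using finite_edges_on[of "{1..n}"] by simp
      show "few_cycle_graphs n (2 * l) L
          \<subseteq> {G. G \<subseteq> edges_on {1..n} \<and> fan_bounded (2 * l - 2) K G}"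
        using few_cycle_graphs_fan_bounded[OF _ \<open>l \<ge> 1\<close> K]
        by (auto simp: few_cycle_graphs_def simple_graphs_eq)
    qed
    also have "real (card {G. G \<subseteq> edges_on {1..n} \<and> fan_bounded (2 * l - 2) K G})
        \<le> (real n * real n * M) ^ card {1..n}"
    proof (rule card_fan_bounded_graphs)
      fix V :: "nat set" and G d v
      assume "finite V" "card V \<le> n" "G \<subseteq> edges_on V" "fan_bounded (2 * l - 2) K G" "v \<notin> V"
        "\<forall>x\<in>V. d \<le> card (nbrs G x) + 1"
      then show "real (card {I. I \<subseteq> V \<and> card I \<le> d \<and> fan_bounded (2 * l - 2) K (G \<union> star v I)}) \<le> M"
        unfolding M_def N_def by (intro elim(1)[rule_format] conjI) auto
    qed (simp_all add: M_def)
    also have "\<dots> = (real n * real n * M) ^ n" by simp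
    also have "\<dots> \<le> (2 powr ((3 * real l + 2) * N)) ^ n"
    proof (intro power_mono)
      have "real n * real n \<le> (real n + 1) * (real n + 1)" by (intro mult_mono) auto
      also have "\<dots> = 2 powr (2 * log 2 (real n + 1))"
        unfolding mult_2 powr_add by simp
      also have "\<dots> \<le> 2 powr N" using elim(2) by (intro powr_mono) (auto simp: N_def)
      finally have "real n * real n * M \<le> 2 powr N * M" by (intro mult_right_mono) (auto simp: M_def)
      also have "\<dots> = 2 powr ((3 * real l + 2) * N)"
        by (simp add: M_def powr_add[symmetric] algebra_simps)
      finally show "real n * real n * M \<le> 2 powr ((3 * real l + 2) * N)" .
    qed (simp add: M_def)
    also have "\<dots> = 2 powr ((3 * real l + 2) * (real n * N))"
      by (simp add: powr_realpow[symmetric] powr_powr mult_ac)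
    also have "real n * N = real n powr (1 + 1 / real l)"
      using n by (simp add: N_def powr_add)
    also have "2 powr ((3 * real l + 2) * real n powr (1 + 1 / real l))
        \<le> 2 powr (3 * (real l + 1) * real n powr (1 + 1 / real l))"
      by (intro powr_mono mult_right_mono) auto
    finally show ?case by (simp only: of_nat_le_iff)
  qed
  then show ?thesis by (simp only: eventually_sequentially)
qed

end
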